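(* Let $\alpha$ be a finite set, $\tau$ an involution on $\alpha$, $S\subseteq\alpha\times\alpha\times\alpha$, and let $n$ and $r$ be positive integers. The map $\Gamma_{n,r}:\mathbb{Z}P(\alpha,\tau,S,r)\to G_n(\alpha,\tau,S,r)$ is a universal invariant of degree $n$.
   Context: Nanophrases and homotopy. An $r$-component Gauss phrase is a sequence of $r$ (possibly empty) finite words, written separated by the symbol $|$, such that every letter occurring in it occurs exactly twice in total. An $r$-component nanophrase over $\alpha$ is an $r$-component Gauss phrase $p$ together with a map $A\mapsto |A|$ from the set of letters appearing in $p$ to $\alpha$. Its rank is its number of distinct letters. Two nanophrases are isomorphic if a bijection of their letter sets preserving the map to $\alpha$ carries one Gauss phrase to the other letterwise. The homotopy given by $(\alpha,\tau,S)$ is the equivalence relation generated by isomorphism and the moves (in both directions) H1: $xAAy\leftrightarrow xy$; H2: $xAByBAz\leftrightarrow xyz$ if $|A|=\tau(|B|)$; H3: $xAByACzBCt\leftrightarrow xBAyCAzCBt$ if $(|A|,|B|,|C|)\in S$; here and below $x,y,z,t$ are arbitrary sequences of letters, possibly including $|$, such that all terms are nanophrases, and letters keep their images in $\alpha$. An involution is a map $\tau$ with $\tau\circ\tau=\mathrm{id}$. Finite type and universal invariants. $P(\alpha,\tau,S,r)$ is the set of homotopy classes of $r$-component nanophrases and $\mathbb{Z}P(\alpha,\tau,S,r)$ the free abelian group on it. A homotopy invariant is a function on $P(\alpha,\tau,S,r)$ with values in an additive abelian group, extended linearly to $\mathbb{Z}P(\alpha,\tau,S,r)$. A nanophrase in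 which a letter $A$ is marked as a semi-letter $\dot A$ denotes $x\dot Ay\dot Az=xAyAz-xyz$, applied recursively for several semi-letters. A homotopy invariant $v$ is a finite type invariant if there is an integer $m$ such that $v(p)=0$ for every nanophrase $p$ with more than $m$ semi-letters; the least such $m\ge 0$ is its degree. A finite type invariant $v$ with values in an abelian group $G$ is a universal invariant of degree $n$ if its degree is at most $n$ and for every finite type invariant $v'$ of degree at most $n$ with values in an abelian group $H$ there is a homomorphism $f:G\to H$ with $v'=f\circ v$ on $\mathbb{Z}P(\alpha,\tau,S,r)$. Groups and $\Gamma_{n,r}$. $\mathbb{Z}\mathcal{I}_r(\alpha)$ is the free abelian group on isomorphism classes of $r$-component nanophrases over $\alpha$. $G(\alpha,\tau,S,r)$ is its quotient by the relations: (1) $xAAy=0$; (2) $xAByBAz+xAyAz+xByBz=0$ whenever $|A|=\tau(|B|)$; (3) $xAByACzBCt+xAByAzBt+xAyACzCt+xByCzBCt=xBAyCAzCBt+xBAyAzBt+xAyCAzCt+xByCzCBt$ whenever $(|A|,|B|,|C|)\in S$. $G_n(\alpha,\tau,S,r)$ is the quotient of $G(\alpha,\tau,S,r)$ by the further relations $p=0$ for all nanophrases $p$ of rank greater than $n$. A subphrase of $p$ is a nanophrase obtained by deleting a (possibly empty) set of letters of $p$ (both occurrences of each); a nanophrase of rank $m$ has $2^m$ subphrases. The linear map sending a nanophrase $p$ to the sum of all its subphrases induces an isomorphism $\hat\theta_r:\mathbb{Z}P(\alpha,\tau,S,r)\to G(\alpha,\tau,S,r)$. $O_n:G(\alpha,\tau,S,r)\to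 G_n(\alpha,\tau,S,r)$ is the homomorphism sending a nanophrase $p$ to $p$ if its rank is at most $n$ and to $0$ otherwise. $\Gamma_{n,r}=O_n\circ\hat\theta_r$. *)

theory Defs
  imports "HOL-Algebra.Free_Abelian_Groups" "HOL-Algebra.Generated_Groups" "HOL-Algebra.Coset"
begin

section \<open>Nanophrases\<close>

text \<open>
  A phrase is a list over letters and the separator \<open>Bar\<close>; it has one more component than it has
  bars. Letters are taken from the infinite supply \<^typ>\<open>nat\<close>, which is no restriction up to
  isomorphism.
\<close>

datatype 'l symbol = Letter 'l | Bar

type_synonym phrase = "nat symbol list"

definition letters :: "phrase \<Rightarrow> nat set" where
  "letters w = {A. Letter A \<in> set w}"

definition gauss_phrase :: "nat \<Rightarrow> phrase \<Rightarrow> bool" where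
  "gauss_phrase r w \<longleftrightarrow>
     count_list w Bar + 1 = r \<and> (\<forall>A\<in>letters w. count_list w (Letter A) = 2)"

text \<open>
  A nanophrase pairs a Gauss phrase with its projection \<open>A \<mapsto> |A|\<close>. Only the values of the
  projection on the letters of the phrase are meaningful: its values elsewhere are ignored by
  isomorphism, hence invisible in every set and group of classes below.
\<close>

type_synonym 'a nanophrase = "phrase \<times> (nat \<Rightarrow> 'a)"

definition nanophrases :: "'a set \<Rightarrow> nat \<Rightarrow> 'a nanophrase set" where
  "nanophrases \<alpha> r = {(w, f). gauss_phrase r w \<and> f ` letters w \<subseteq> \<alpha>}"

definition rank :: "'a nanophrase \<Rightarrow> nat" where
  "rank p = card (letters (fst p))"

definition isomorphic :: "'a nanophrase \<Rightarrow> 'a nanophrase \<Rightarrow> bool" where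
  "isomorphic p q \<longleftrightarrow>
     (\<exists>\<sigma>. bij_betw \<sigma> (letters (fst p)) (letters (fst q)) \<and>
          (\<forall>A\<in>letters (fst p). snd q (\<sigma> A) = snd p A) \<and>
          fst q = map (map_symbol \<sigma>) (fst p))"

definition delete_letters :: "nat set \<Rightarrow> 'a nanophrase \<Rightarrow> 'a nanophrase" where
  "delete_letters D p = (filter (\<lambda>s. s \<notin> Letter ` D) (fst p), snd p)"


section \<open>Homotopy\<close>

text \<open>
  In each move only one side is required to be a nanophrase; the other side arises from it by
  deleting or permuting letters and is then a nanophrase too. Distinctness of \<open>A\<close>, \<open>B\<close>, \<open>C\<close> is forced
  because every letter occurs exactly twice.
\<close>

inductive homotopy_step ::
  "'a set \<Rightarrow> ('a \<Rightarrow> 'a) \<Rightarrow> ('a \<times> 'a \<times> 'a) set \<Rightarrow> nat \<Rightarrow> 'a nanophrase \<Rightarrow> 'a nanophrase \<Rightarrow> bool"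
  for \<alpha> \<tau> S r where
  iso: "p \<in> nanophrases \<alpha> r \<Longrightarrow> q \<in> nanophrases \<alpha> r \<Longrightarrow> isomorphic p q \<Longrightarrow>
    homotopy_step \<alpha> \<tau> S r p q"
| H1: "(x @ [Letter A, Letter A] @ y, f) \<in> nanophrases \<alpha> r \<Longrightarrow>
    homotopy_step \<alpha> \<tau> S r (x @ [Letter A, Letter A] @ y, f) (x @ y, f)"
| H2: "(x @ [Letter A, Letter B] @ y @ [Letter B, Letter A] @ z, f) \<in> nanophrases \<alpha> r \<Longrightarrow>
    f A = \<tau> (f B) \<Longrightarrow>
    homotopy_step \<alpha> \<tau> S r
      (x @ [Letter A, Letter B] @ y @ [Letter B, Letter A] @ z, f) (x @ y @ z, f)"
| H3: "(x @ [Letter A, Letter B] @ y @ [Letter A, Letter C] @ z @ [Letter B, Letter C] @ t, f)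
      \<in> nanophrases \<alpha> r \<Longrightarrow>
    (f A, f B, f C) \<in> S \<Longrightarrow>
    homotopy_step \<alpha> \<tau> S r
      (x @ [Letter A, Letter B] @ y @ [Letter A, Letter C] @ z @ [Letter B, Letter C] @ t, f)
      (x @ [Letter B, Letter A] @ y @ [Letter C, Letter A] @ z @ [Letter C, Letter B] @ t, f)"

definition homotopy ::
  "'a set \<Rightarrow> ('a \<Rightarrow> 'a) \<Rightarrow> ('a \<times> 'a \<times> 'a) set \<Rightarrow> nat \<Rightarrow> ('a nanophrase \<times> 'a nanophrase) set" where
  "homotopy \<alpha> \<tau> S r = {(p, q). equivclp (homotopy_step \<alpha> \<tau> S r) p q}"

definition homotopy_classes ::
  "'a set \<Rightarrow> ('a \<Rightarrow> 'a) \<Rightarrow> ('a \<times> 'a \<times> 'a) set \<Rightarrow> nat \<Rightarrow> 'a nanophrase set set" where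
  "homotopy_classes \<alpha> \<tau> S r = nanophrases \<alpha> r // homotopy \<alpha> \<tau> S r"

definition ZP ::
  "'a set \<Rightarrow> ('a \<Rightarrow> 'a) \<Rightarrow> ('a \<times> 'a \<times> 'a) set \<Rightarrow> nat \<Rightarrow> ('a nanophrase set \<Rightarrow>\<^sub>0 int) monoid" where
  "ZP \<alpha> \<tau> S r = free_Abelian_group (homotopy_classes \<alpha> \<tau> S r)"

definition hclass ::
  "'a set \<Rightarrow> ('a \<Rightarrow> 'a) \<Rightarrow> ('a \<times> 'a \<times> 'a) set \<Rightarrow> nat \<Rightarrow> 'a nanophrase \<Rightarrow>
   ('a nanophrase set \<Rightarrow>\<^sub>0 int)" where
  "hclass \<alpha> \<tau> S r p = frag_of (homotopy \<alpha> \<tau> S r `` {p})"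


section \<open>Finite type and universal invariants\<close>

text \<open>
  \<open>semi \<alpha> \<tau> S r As p\<close> is the element of \<open>ZP\<close> denoted by \<open>p\<close> with the letters in the list \<open>As\<close>
  marked as semi-letters.
\<close>

primrec semi ::
  "'a set \<Rightarrow> ('a \<Rightarrow> 'a) \<Rightarrow> ('a \<times> 'a \<times> 'a) set \<Rightarrow> nat \<Rightarrow> nat list \<Rightarrow> 'a nanophrase \<Rightarrow>
   ('a nanophrase set \<Rightarrow>\<^sub>0 int)" where
  "semi \<alpha> \<tau> S r [] p = hclass \<alpha> \<tau> S r p"
| "semi \<alpha> \<tau> S r (A # As) p = semi \<alpha> \<tau> S r As p - semi \<alpha> \<tau> S r As (delete_letters {A} p)"

text \<open>A function on homotopy classes extended linearly is a homomorphism on the free group \<open>ZP\<close>.\<close>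

definition homotopy_invariant ::
  "'a set \<Rightarrow> ('a \<Rightarrow> 'a) \<Rightarrow> ('a \<times> 'a \<times> 'a) set \<Rightarrow> nat \<Rightarrow>
   'g monoid \<Rightarrow> (('a nanophrase set \<Rightarrow>\<^sub>0 int) \<Rightarrow> 'g) \<Rightarrow> bool" where
  "homotopy_invariant \<alpha> \<tau> S r G v \<longleftrightarrow> comm_group G \<and> v \<in> hom (ZP \<alpha> \<tau> S r) G"

definition vanishes_above ::
  "'a set \<Rightarrow> ('a \<Rightarrow> 'a) \<Rightarrow> ('a \<times> 'a \<times> 'a) set \<Rightarrow> nat \<Rightarrow>
   'g monoid \<Rightarrow> (('a nanophrase set \<Rightarrow>\<^sub>0 int) \<Rightarrow> 'g) \<Rightarrow> nat \<Rightarrow> bool" where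
  "vanishes_above \<alpha> \<tau> S r G v m \<longleftrightarrow>
     (\<forall>p\<in>nanophrases \<alpha> r. \<forall>As. distinct As \<and> set As \<subseteq> letters (fst p) \<and> length As > m \<longrightarrow>
        v (semi \<alpha> \<tau> S r As p) = \<one>\<^bsub>G\<^esub>)"

definition finite_type_invariant ::
  "'a set \<Rightarrow> ('a \<Rightarrow> 'a) \<Rightarrow> ('a \<times> 'a \<times> 'a) set \<Rightarrow> nat \<Rightarrow>
   'g monoid \<Rightarrow> (('a nanophrase set \<Rightarrow>\<^sub>0 int) \<Rightarrow> 'g) \<Rightarrow> bool" where
  "finite_type_invariant \<alpha> \<tau> S r G v \<longleftrightarrow>
     homotopy_invariant \<alpha> \<tau> S r G v \<and> (\<exists>m. vanishes_above \<alpha> \<tau> S r G v m)"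

definition ft_degree ::
  "'a set \<Rightarrow> ('a \<Rightarrow> 'a) \<Rightarrow> ('a \<times> 'a \<times> 'a) set \<Rightarrow> nat \<Rightarrow>
   'g monoid \<Rightarrow> (('a nanophrase set \<Rightarrow>\<^sub>0 int) \<Rightarrow> 'g) \<Rightarrow> nat" where
  "ft_degree \<alpha> \<tau> S r G v = (LEAST m. vanishes_above \<alpha> \<tau> S r G v m)"

text \<open>
  HOL cannot quantify over types inside a formula, so the type of the elements of the test groups
  is passed as an argument; a theorem about \<open>TYPE('h)\<close> with \<open>'h\<close> a type variable covers all of them.
\<close>

definition universal_invariant ::
  "'h itself \<Rightarrow> 'a set \<Rightarrow> ('a \<Rightarrow> 'a) \<Rightarrow> ('a \<times> 'a \<times> 'a) set \<Rightarrow> nat \<Rightarrow> nat \<Rightarrow>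
   'g monoid \<Rightarrow> (('a nanophrase set \<Rightarrow>\<^sub>0 int) \<Rightarrow> 'g) \<Rightarrow> bool" where
  "universal_invariant (_ :: 'h itself) \<alpha> \<tau> S r n G v \<longleftrightarrow>
     finite_type_invariant \<alpha> \<tau> S r G v \<and> ft_degree \<alpha> \<tau> S r G v \<le> n \<and>
     (\<forall>(H :: 'h monoid) v'.
        finite_type_invariant \<alpha> \<tau> S r H v' \<and> ft_degree \<alpha> \<tau> S r H v' \<le> n \<longrightarrow>
        (\<exists>f\<in>hom G H. \<forall>x\<in>carrier (ZP \<alpha> \<tau> S r). v' x = f (v x)))"


section \<open>The groups and the map\<close>

definition isomorphism_rel :: "'a set \<Rightarrow> nat \<Rightarrow> ('a nanophrase \<times> 'a nanophrase) set" where
  "isomorphism_rel \<alpha> r =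
     {(p, q). p \<in> nanophrases \<alpha> r \<and> q \<in> nanophrases \<alpha> r \<and> isomorphic p q}"

definition ZI :: "'a set \<Rightarrow> nat \<Rightarrow> ('a nanophrase set \<Rightarrow>\<^sub>0 int) monoid" where
  "ZI \<alpha> r = free_Abelian_group (nanophrases \<alpha> r // isomorphism_rel \<alpha> r)"

definition iclass :: "'a set \<Rightarrow> nat \<Rightarrow> 'a nanophrase \<Rightarrow> ('a nanophrase set \<Rightarrow>\<^sub>0 int)" where
  "iclass \<alpha> r p = frag_of (isomorphism_rel \<alpha> r `` {p})"

text \<open>As in the moves, all terms are nanophrases as soon as the first one is.\<close>

inductive_set relators ::
  "'a set \<Rightarrow> ('a \<Rightarrow> 'a) \<Rightarrow> ('a \<times> 'a \<times> 'a) set \<Rightarrow> nat \<Rightarrow> ('a nanophrase set \<Rightarrow>\<^sub>0 int) set"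
  for \<alpha> \<tau> S r where
  R1: "(x @ [Letter A, Letter A] @ y, f) \<in> nanophrases \<alpha> r \<Longrightarrow>
    iclass \<alpha> r (x @ [Letter A, Letter A] @ y, f) \<in> relators \<alpha> \<tau> S r"
| R2: "(x @ [Letter A, Letter B] @ y @ [Letter B, Letter A] @ z, f) \<in> nanophrases \<alpha> r \<Longrightarrow>
    f A = \<tau> (f B) \<Longrightarrow>
      iclass \<alpha> r (x @ [Letter A, Letter B] @ y @ [Letter B, Letter A] @ z, f)
    + iclass \<alpha> r (x @ [Letter A] @ y @ [Letter A] @ z, f)
    + iclass \<alpha> r (x @ [Letter B] @ y @ [Letter B] @ z, f)
    \<in> relators \<alpha> \<tau> S r"
| R3: "(x @ [Letter A, Letter B] @ y @ [Letter A, Letter C] @ z @ [Letter B, Letter C] @ t, f)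
      \<in> nanophrases \<alpha> r \<Longrightarrow>
    (f A, f B, f C) \<in> S \<Longrightarrow>
      (iclass \<alpha> r
         (x @ [Letter A, Letter B] @ y @ [Letter A, Letter C] @ z @ [Letter B, Letter C] @ t, f)
     + iclass \<alpha> r (x @ [Letter A, Letter B] @ y @ [Letter A] @ z @ [Letter B] @ t, f)
     + iclass \<alpha> r (x @ [Letter A] @ y @ [Letter A, Letter C] @ z @ [Letter C] @ t, f)
     + iclass \<alpha> r (x @ [Letter B] @ y @ [Letter C] @ z @ [Letter B, Letter C] @ t, f))
    - (iclass \<alpha> r
         (x @ [Letter B, Letter A] @ y @ [Letter C, Letter A] @ z @ [Letter C, Letter B] @ t, f)
     + iclass \<alpha> r (x @ [Letter B, Letter A] @ y @ [Letter A] @ z @ [Letter B] @ t, f)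
     + iclass \<alpha> r (x @ [Letter A] @ y @ [Letter C, Letter A] @ z @ [Letter C] @ t, f)
     + iclass \<alpha> r (x @ [Letter B] @ y @ [Letter C] @ z @ [Letter C, Letter B] @ t, f))
    \<in> relators \<alpha> \<tau> S r"

definition relator_subgroup ::
  "'a set \<Rightarrow> ('a \<Rightarrow> 'a) \<Rightarrow> ('a \<times> 'a \<times> 'a) set \<Rightarrow> nat \<Rightarrow> ('a nanophrase set \<Rightarrow>\<^sub>0 int) set" where
  "relator_subgroup \<alpha> \<tau> S r = generate (ZI \<alpha> r) (relators \<alpha> \<tau> S r)"

definition G_grp ::
  "'a set \<Rightarrow> ('a \<Rightarrow> 'a) \<Rightarrow> ('a \<times> 'a \<times> 'a) set \<Rightarrow> nat \<Rightarrow>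
   ('a nanophrase set \<Rightarrow>\<^sub>0 int) set monoid" where
  "G_grp \<alpha> \<tau> S r = ZI \<alpha> r Mod relator_subgroup \<alpha> \<tau> S r"

definition G_proj ::
  "'a set \<Rightarrow> ('a \<Rightarrow> 'a) \<Rightarrow> ('a \<times> 'a \<times> 'a) set \<Rightarrow> nat \<Rightarrow>
   ('a nanophrase set \<Rightarrow>\<^sub>0 int) \<Rightarrow> ('a nanophrase set \<Rightarrow>\<^sub>0 int) set" where
  "G_proj \<alpha> \<tau> S r c = relator_subgroup \<alpha> \<tau> S r #>\<^bsub>ZI \<alpha> r\<^esub> c"

definition high_rank_subgroup ::
  "nat \<Rightarrow> 'a set \<Rightarrow> ('a \<Rightarrow> 'a) \<Rightarrow> ('a \<times> 'a \<times> 'a) set \<Rightarrow> nat \<Rightarrow>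
   ('a nanophrase set \<Rightarrow>\<^sub>0 int) set set" where
  "high_rank_subgroup n \<alpha> \<tau> S r =
     generate (G_grp \<alpha> \<tau> S r)
       {G_proj \<alpha> \<tau> S r (iclass \<alpha> r p) | p. p \<in> nanophrases \<alpha> r \<and> rank p > n}"

definition Gn ::
  "nat \<Rightarrow> 'a set \<Rightarrow> ('a \<Rightarrow> 'a) \<Rightarrow> ('a \<times> 'a \<times> 'a) set \<Rightarrow> nat \<Rightarrow>
   ('a nanophrase set \<Rightarrow>\<^sub>0 int) set set monoid" where
  "Gn n \<alpha> \<tau> S r = G_grp \<alpha> \<tau> S r Mod high_rank_subgroup n \<alpha> \<tau> S r"

definition Gn_proj ::
  "nat \<Rightarrow> 'a set \<Rightarrow> ('a \<Rightarrow> 'a) \<Rightarrow> ('a \<times> 'a \<times> 'a) set \<Rightarrow> nat \<Rightarrow>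
   ('a nanophrase set \<Rightarrow>\<^sub>0 int) set \<Rightarrow> ('a nanophrase set \<Rightarrow>\<^sub>0 int) set set" where
  "Gn_proj n \<alpha> \<tau> S r c = high_rank_subgroup n \<alpha> \<tau> S r #>\<^bsub>G_grp \<alpha> \<tau> S r\<^esub> c"

definition subphrase_sum :: "'a set \<Rightarrow> nat \<Rightarrow> 'a nanophrase \<Rightarrow> ('a nanophrase set \<Rightarrow>\<^sub>0 int)" where
  "subphrase_sum \<alpha> r p = (\<Sum>D\<in>Pow (letters (fst p)). iclass \<alpha> r (delete_letters D p))"

text \<open>
  The maps \<open>\<theta>\<^sub>r\<close> (with hat) and \<open>O\<^sub>n\<close> are the unique homomorphisms with the prescribed values on the
  classes of nanophrases, which generate; \<^const>\<open>extensional\<close> only fixes the irrelevant values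
  outside the domain, so that the description is unique.
\<close>

definition theta_hat ::
  "'a set \<Rightarrow> ('a \<Rightarrow> 'a) \<Rightarrow> ('a \<times> 'a \<times> 'a) set \<Rightarrow> nat \<Rightarrow>
   ('a nanophrase set \<Rightarrow>\<^sub>0 int) \<Rightarrow> ('a nanophrase set \<Rightarrow>\<^sub>0 int) set" where
  "theta_hat \<alpha> \<tau> S r =
     (THE h. h \<in> hom (ZP \<alpha> \<tau> S r) (G_grp \<alpha> \<tau> S r) \<and> h \<in> extensional (carrier (ZP \<alpha> \<tau> S r)) \<and>
        (\<forall>p\<in>nanophrases \<alpha> r. h (hclass \<alpha> \<tau> S r p) = G_proj \<alpha> \<tau> S r (subphrase_sum \<alpha> r p)))"

definition O_map ::
  "nat \<Rightarrow> 'a set \<Rightarrow> ('a \<Rightarrow> 'a) \<Rightarrow> ('a \<times> 'a \<times> 'a) set \<Rightarrow> nat \<Rightarrow>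
   ('a nanophrase set \<Rightarrow>\<^sub>0 int) set \<Rightarrow> ('a nanophrase set \<Rightarrow>\<^sub>0 int) set set" where
  "O_map n \<alpha> \<tau> S r =
     (THE h. h \<in> hom (G_grp \<alpha> \<tau> S r) (Gn n \<alpha> \<tau> S r) \<and> h \<in> extensional (carrier (G_grp \<alpha> \<tau> S r)) \<and>
        (\<forall>p\<in>nanophrases \<alpha> r. h (G_proj \<alpha> \<tau> S r (iclass \<alpha> r p)) =
           (if rank p \<le> n then Gn_proj n \<alpha> \<tau> S r (G_proj \<alpha> \<tau> S r (iclass \<alpha> r p))
            else \<one>\<^bsub>Gn n \<alpha> \<tau> S r\<^esub>)))"

definition Gamma ::
  "nat \<Rightarrow> 'a set \<Rightarrow> ('a \<Rightarrow> 'a) \<Rightarrow> ('a \<times> 'a \<times> 'a) set \<Rightarrow> nat \<Rightarrow>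
   ('a nanophrase set \<Rightarrow>\<^sub>0 int) \<Rightarrow> ('a nanophrase set \<Rightarrow>\<^sub>0 int) set set" where
  "Gamma n \<alpha> \<tau> S r = O_map n \<alpha> \<tau> S r \<circ> theta_hat \<alpha> \<tau> S r"

end

theory Submission
  imports Defs
begin

text \<open>
  Write \<open>\<theta>(p)\<close> for the sum of all subphrases of \<open>p\<close>, and \<open>\<psi>(p)\<close> for \<open>p\<close> with all its letters
  turned into semi-letters, that is, the alternating sum of all subphrases. By inclusion and
  exclusion the two expansions are inverse to each other, provided that both make sense:
  \<open>\<theta>\<close> starts from homotopy classes and takes values in \<open>G\<close>, while \<open>\<psi>\<close> starts from isomorphism
  classes and takes values in the free group on homotopy classes. The three relations of \<open>G\<close> are
  what makes this work. Group the subphrases of the two sides of a move by the part that lies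
  outside the letters \<open>A\<close>, \<open>B\<close>, \<open>C\<close> of the move. For \<open>\<theta>\<close>, the difference of the two sides of a
  group is precisely a relator (\<open>subphrase_sum_homotopy\<close>). For \<open>\<psi>\<close>, the relators cancel by the
  move, applied once to each group (\<open>all_semi_map_relators\<close>).

  Marking letters as semi-letters corresponds under \<open>\<theta>\<close> to keeping only the subphrases that
  contain all marked letters (\<open>subphrase_lift_semi\<close>). With more than \<open>n\<close> marked letters only
  subphrases of rank greater than \<open>n\<close> are left, and they are zero in \<open>G\<^sub>n\<close>; hence \<open>\<Gamma>\<close> has degree
  at most \<open>n\<close> (\<open>Gamma_vanishes\<close>).

  Conversely let \<open>v\<close> be a finite type invariant of degree at most \<open>n\<close>. The homomorphism \<open>v \<circ> \<psi>\<close>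
  kills the relators since \<open>\<psi>\<close> does, and it kills every \<open>p\<close> of rank greater than \<open>n\<close> since \<open>\<psi>(p)\<close>
  is a phrase with more than \<open>n\<close> semi-letters. So it factors through a homomorphism \<open>f\<close> on \<open>G\<^sub>n\<close>
  (\<open>hom_Gn_factorization\<close>), and \<open>f \<circ> \<Gamma> = v \<circ> \<psi> \<circ> \<theta> = v\<close> (\<open>all_semi_map_subphrase_lift\<close>).
\<close>

section \<open>Deleting letters\<close>

lemma finite_letters [simp]: "finite (letters w)"
proof -
  have "Letter ` letters w \<subseteq> set w"
    by (auto simp: letters_def)
  then have "finite (Letter ` letters w)"
    by (rule finite_subset) simp
  then show ?thesis
    by (rule finite_imageD) (simp add: inj_on_def)
qed

lemma letters_delete_letters [simp]:
  "letters (fst (delete_letters D p)) = letters (fst p) - D"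
  by (auto simp: letters_def delete_letters_def)

lemma snd_delete_letters [simp]: "snd (delete_letters D p) = snd p"
  by (simp add: delete_letters_def)

lemma delete_letters_empty [simp]: "delete_letters {} p = p"
  by (simp add: delete_letters_def)

lemma delete_letters_delete_letters:
  "delete_letters D (delete_letters E p) = delete_letters (D \<union> E) p"
  by (auto simp: delete_letters_def intro: filter_cong)

lemma delete_letters_commute:
  "delete_letters D (delete_letters E p) = delete_letters E (delete_letters D p)"
  by (simp add: delete_letters_delete_letters Un_commute)

lemma count_list_filter: "count_list (filter P xs) x = (if P x then count_list xs x else 0)"
  by (induction xs) auto

lemma delete_letters_nanophrases:
  "p \<in> nanophrases \<alpha> r \<Longrightarrow> delete_letters D p \<in> nanophrases \<alpha> r"
  by (auto simp: nanophrases_def gauss_phrase_def delete_letters_def letters_def count_list_filter)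

lemma nanophrases_count:
  "p \<in> nanophrases \<alpha> r \<Longrightarrow> Letter A \<in> set (fst p) \<Longrightarrow> count_list (fst p) (Letter A) = 2"
  by (auto simp: nanophrases_def gauss_phrase_def letters_def)

section \<open>Isomorphism and the classes\<close>

lemma isomorphic_refl: "isomorphic p p"
  unfolding isomorphic_def by (rule exI[of _ id]) (simp add: symbol.map_id0)

lemma isomorphic_sym:
  assumes "isomorphic p q" shows "isomorphic q p"
proof -
  obtain \<sigma> where b: "bij_betw \<sigma> (letters (fst p)) (letters (fst q))"
    and v: "\<forall>A\<in>letters (fst p). snd q (\<sigma> A) = snd p A"
    and w: "fst q = map (map_symbol \<sigma>) (fst p)"
    using assms by (auto simp: isomorphic_def)
  define \<rho> where "\<rho> = inv_into (letters (fst p)) \<sigma>"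
  have \<rho>: "bij_betw \<rho> (letters (fst q)) (letters (fst p))"
    using b by (simp add: \<rho>_def bij_betw_inv_into)
  have "map_symbol \<rho> (map_symbol \<sigma> s) = s" if "s \<in> set (fst p)" for s
  proof (cases s)
    case (Letter A)
    then have "A \<in> letters (fst p)"
      using that by (simp add: letters_def)
    then show ?thesis
      using b by (simp add: Letter \<rho>_def bij_betw_def)
  qed simp
  then have "fst p = map (map_symbol \<rho>) (fst q)"
    by (simp add: w map_idI)
  moreover have "snd p (\<rho> A) = snd q A" if "A \<in> letters (fst q)" for A
  proof -
    have "\<rho> A \<in> letters (fst p)" "\<sigma> (\<rho> A) = A"
      using that b \<rho> unfolding \<rho>_def
      by (auto simp: bij_betw_def inv_into_into f_inv_into_f)
    then show ?thesis using v by metis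
  qed
  ultimately show ?thesis
    using \<rho> by (auto simp: isomorphic_def)
qed

lemma isomorphic_trans:
  assumes "isomorphic p q" "isomorphic q s" shows "isomorphic p s"
proof -
  obtain \<sigma> where b: "bij_betw \<sigma> (letters (fst p)) (letters (fst q))"
    and v: "\<forall>A\<in>letters (fst p). snd q (\<sigma> A) = snd p A"
    and w: "fst q = map (map_symbol \<sigma>) (fst p)"
    using assms(1) by (auto simp: isomorphic_def)
  obtain \<rho> where b': "bij_betw \<rho> (letters (fst q)) (letters (fst s))"
    and v': "\<forall>A\<in>letters (fst q). snd s (\<rho> A) = snd q A"
    and w': "fst s = map (map_symbol \<rho>) (fst q)"
    using assms(2) by (auto simp: isomorphic_def)
  show ?thesis
    unfolding isomorphic_def
  proof (intro exI conjI)
    show "bij_betw (\<rho> \<circ> \<sigma>) (letters (fst p)) (letters (fst s))"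
      using b b' by (rule bij_betw_trans)
    show "\<forall>A\<in>letters (fst p). snd s ((\<rho> \<circ> \<sigma>) A) = snd p A"
      using bij_betw_apply[OF b] v v' by simp
    show "fst s = map (map_symbol (\<rho> \<circ> \<sigma>)) (fst p)"
      by (simp add: w w' symbol.map_comp)
  qed
qed

text \<open>
  An isomorphism restricts to the letters that remain. The bijection \<open>\<sigma>\<close> is explicit because the
  set of letters to delete on the other side is its image; \<open>\<sigma>\<close> thus matches the subphrases of
  \<open>p\<close> with those of \<open>q\<close>.
\<close>

lemma isomorphic_delete_letters:
  assumes "bij_betw \<sigma> (letters (fst p)) (letters (fst q))"
    and "\<forall>A\<in>letters (fst p). snd q (\<sigma> A) = snd p A"
    and "fst q = map (map_symbol \<sigma>) (fst p)"
    and "D \<subseteq> letters (fst p)"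
  shows "isomorphic (delete_letters D p) (delete_letters (\<sigma> ` D) q)"
  unfolding isomorphic_def
proof (intro exI conjI)
  have inj: "inj_on \<sigma> (letters (fst p))"
    using assms(1) by (simp add: bij_betw_def)
  show "bij_betw \<sigma> (letters (fst (delete_letters D p)))
      (letters (fst (delete_letters (\<sigma> ` D) q)))"
    using assms(1,4)
    by (auto simp: bij_betw_def inj_on_image_set_diff[OF inj] intro: inj_on_subset[OF inj])
  show "\<forall>A\<in>letters (fst (delete_letters D p)).
      snd (delete_letters (\<sigma> ` D) q) (\<sigma> A) = snd (delete_letters D p) A"
    using assms(2) by simp
  have "map_symbol \<sigma> s \<notin> Letter ` \<sigma> ` D \<longleftrightarrow> s \<notin> Letter ` D" if "s \<in> set (fst p)" for s
  proof (cases s)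
    case (Letter A)
    then have "A \<in> letters (fst p)"
      using that by (simp add: letters_def)
    then show ?thesis
      using inj assms(4) by (simp add: Letter image_iff inj_on_def) blast
  qed auto
  then show "fst (delete_letters (\<sigma> ` D) q) = map (map_symbol \<sigma>) (fst (delete_letters D p))"
    by (auto simp: delete_letters_def assms(3) filter_map intro!: arg_cong[where f = "map _"] filter_cong)
qed

lemma equiv_isomorphism_rel: "equiv (nanophrases \<alpha> r) (isomorphism_rel \<alpha> r)"
  by (rule equivI)
    (auto simp: isomorphism_rel_def refl_on_def sym_def trans_def
      intro: isomorphic_refl isomorphic_sym isomorphic_trans)

lemma iclass_isomorphic:
  "p \<in> nanophrases \<alpha> r \<Longrightarrow> q \<in> nanophrases \<alpha> r \<Longrightarrow> isomorphic p q \<Longrightarrow>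
    iclass \<alpha> r p = iclass \<alpha> r q"
  unfolding iclass_def
  by (subst equiv_class_eq[OF equiv_isomorphism_rel]) (auto simp: isomorphism_rel_def)

text \<open>
  The equivalence closure lives on all pairs, also on those that are not nanophrases, where it is
  the identity. This makes equality of classes available without side conditions.
\<close>

lemma equiv_homotopy: "equiv UNIV (homotopy \<alpha> \<tau> S r)"
  by (rule equivI)
    (auto simp: homotopy_def refl_on_def sym_def trans_def
      intro: equivclp_sym equivclp_trans)

lemma hclass_eq_iff: "hclass \<alpha> \<tau> S r p = hclass \<alpha> \<tau> S r q \<longleftrightarrow> (p, q) \<in> homotopy \<alpha> \<tau> S r"
  using eq_equiv_class_iff[OF equiv_homotopy, of p q \<alpha> \<tau> S r]
  by (simp add: hclass_def frag_of_eq)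

lemma hclass_step: "homotopy_step \<alpha> \<tau> S r p q \<Longrightarrow> hclass \<alpha> \<tau> S r p = hclass \<alpha> \<tau> S r q"
  by (simp add: hclass_eq_iff homotopy_def r_into_equivclp)

section \<open>Sites of the moves and of the relations\<close>

text \<open>
  A site records that a move applies at given letters, but not the words around them. All proofs
  below group the subphrases of \<open>p\<close> by the letters outside the site, and they need only that
  deleting such letters keeps the site, that is, leaves a phrase to which the same move applies.
\<close>

definition H1_site :: "nat \<Rightarrow> 'a nanophrase \<Rightarrow> bool" where
  "H1_site A p \<longleftrightarrow> (\<exists>x y. fst p = x @ [Letter A, Letter A] @ y)"

definition H2_site :: "('a \<Rightarrow> 'a) \<Rightarrow> nat \<Rightarrow> nat \<Rightarrow> 'a nanophrase \<Rightarrow> bool" where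
  "H2_site \<tau> A B p \<longleftrightarrow> snd p A = \<tau> (snd p B) \<and>
    (\<exists>x y z. fst p = x @ [Letter A, Letter B] @ y @ [Letter B, Letter A] @ z)"

definition H3_site ::
  "('a \<times> 'a \<times> 'a) set \<Rightarrow> nat \<Rightarrow> nat \<Rightarrow> nat \<Rightarrow> 'a nanophrase \<Rightarrow> 'a nanophrase \<Rightarrow> bool" where
  "H3_site S A B C p q \<longleftrightarrow> (snd p A, snd p B, snd p C) \<in> S \<and> snd q = snd p \<and>
    (\<exists>x y z t.
      fst p = x @ [Letter A, Letter B] @ y @ [Letter A, Letter C] @ z @ [Letter B, Letter C] @ t \<and>
      fst q = x @ [Letter B, Letter A] @ y @ [Letter C, Letter A] @ z @ [Letter C, Letter B] @ t)"

lemma H1_site_delete_letters: "H1_site A p \<Longrightarrow> A \<notin> D \<Longrightarrow> H1_site A (delete_letters D p)"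
  by (fastforce simp: H1_site_def delete_letters_def)

lemma H2_site_delete_letters:
  "H2_site \<tau> A B p \<Longrightarrow> A \<notin> D \<Longrightarrow> B \<notin> D \<Longrightarrow> H2_site \<tau> A B (delete_letters D p)"
  unfolding H2_site_def
  by (elim conjE exE)
    (simp add: delete_letters_def image_iff, metis)

lemma H3_site_delete_letters:
  assumes "H3_site S A B C p q" "A \<notin> D" "B \<notin> D" "C \<notin> D"
  shows "H3_site S A B C (delete_letters D p) (delete_letters D q)"
proof -
  let ?f = "filter (\<lambda>s. s \<notin> Letter ` D)"
  obtain x y z t where
    "fst p = x @ [Letter A, Letter B] @ y @ [Letter A, Letter C] @ z @ [Letter B, Letter C] @ t"
    "fst q = x @ [Letter B, Letter A] @ y @ [Letter C, Letter A] @ z @ [Letter C, Letter B] @ t"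
    using assms(1) by (auto simp: H3_site_def)
  then have
    "fst (delete_letters D p) = ?f x @ [Letter A, Letter B] @ ?f y @ [Letter A, Letter C]
      @ ?f z @ [Letter B, Letter C] @ ?f t"
    "fst (delete_letters D q) = ?f x @ [Letter B, Letter A] @ ?f y @ [Letter C, Letter A]
      @ ?f z @ [Letter C, Letter B] @ ?f t"
    using assms(2-4) by (auto simp: delete_letters_def)
  then show ?thesis
    using assms(1) unfolding H3_site_def by auto
qed

lemma H3_site_right_nanophrase:
  assumes "H3_site S A B C p q" "p \<in> nanophrases \<alpha> r"
  shows "q \<in> nanophrases \<alpha> r"
proof -
  have "set (fst q) = set (fst p)" "count_list (fst q) s = count_list (fst p) s" for s
    using assms(1) by (auto simp: H3_site_def)
  then show ?thesis
    using assms
    by (cases p; cases q) (auto simp: H3_site_def nanophrases_def gauss_phrase_def letters_def)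
qed

lemma H1_site_delete:
  assumes "(x @ [Letter A, Letter A] @ y, f) \<in> nanophrases \<alpha> r"
  shows "delete_letters {A} (x @ [Letter A, Letter A] @ y, f) = (x @ y, f)"
  using nanophrases_count[OF assms, of A]
  by (auto simp: delete_letters_def count_list_0_iff
      intro!: arg_cong2[where f = "(@)"] filter_True)

lemma H2_site_delete:
  assumes "(x @ [Letter A, Letter B] @ y @ [Letter B, Letter A] @ z, f) \<in> nanophrases \<alpha> r"
    (is "(?w, f) \<in> _")
  shows "A \<noteq> B"
    and "delete_letters {A} (?w, f) = (x @ [Letter B] @ y @ [Letter B] @ z, f)"
    and "delete_letters {B} (?w, f) = (x @ [Letter A] @ y @ [Letter A] @ z, f)"
    and "delete_letters {A, B} (?w, f) = (x @ y @ z, f)"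
proof -
  show "A \<noteq> B"
    using nanophrases_count[OF assms, of A] by auto
  then have "Letter A \<notin> set (x @ y @ z)" "Letter B \<notin> set (x @ y @ z)"
    using nanophrases_count[OF assms, of A] nanophrases_count[OF assms, of B]
    by (auto simp: count_list_0_iff)
  then show "delete_letters {A} (?w, f) = (x @ [Letter B] @ y @ [Letter B] @ z, f)"
    "delete_letters {B} (?w, f) = (x @ [Letter A] @ y @ [Letter A] @ z, f)"
    "delete_letters {A, B} (?w, f) = (x @ y @ z, f)"
    using \<open>A \<noteq> B\<close>
    by (auto simp: delete_letters_def intro!: arg_cong2[where f = "(@)"] filter_True)
qed

lemma H2_site_distinct: "H2_site \<tau> A B p \<Longrightarrow> p \<in> nanophrases \<alpha> r \<Longrightarrow> A \<noteq> B"
  using H2_site_delete(1) by (cases p) (fastforce simp: H2_site_def)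

lemma H3_site_distinct:
  assumes "H3_site S A B C p q" "p \<in> nanophrases \<alpha> r"
  shows "A \<noteq> B" "A \<noteq> C" "B \<noteq> C"
  using assms(1) nanophrases_count[OF assms(2), of A] nanophrases_count[OF assms(2), of B]
    nanophrases_count[OF assms(2), of C]
  by (auto simp: H3_site_def split: if_splits)

lemma H3_site_delete:
  assumes "(x @ [Letter A, Letter B] @ y @ [Letter A, Letter C] @ z @ [Letter B, Letter C] @ t, f)
      \<in> nanophrases \<alpha> r" (is "(?w, f) \<in> _")
  defines "w' \<equiv> x @ [Letter B, Letter A] @ y @ [Letter C, Letter A] @ z @ [Letter C, Letter B] @ t"
  shows "delete_letters {A} (?w, f) = (x @ [Letter B] @ y @ [Letter C] @ z @ [Letter B, Letter C] @ t, f)"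
    and "delete_letters {B} (?w, f) = (x @ [Letter A] @ y @ [Letter A, Letter C] @ z @ [Letter C] @ t, f)"
    and "delete_letters {C} (?w, f) = (x @ [Letter A, Letter B] @ y @ [Letter A] @ z @ [Letter B] @ t, f)"
    and "delete_letters {A} (w', f) = (x @ [Letter B] @ y @ [Letter C] @ z @ [Letter C, Letter B] @ t, f)"
    and "delete_letters {B} (w', f) = (x @ [Letter A] @ y @ [Letter C, Letter A] @ z @ [Letter C] @ t, f)"
    and "delete_letters {C} (w', f) = (x @ [Letter B, Letter A] @ y @ [Letter A] @ z @ [Letter B] @ t, f)"
proof -
  have ne: "A \<noteq> B" "A \<noteq> C" "B \<noteq> C"
    using nanophrases_count[OF assms(1), of A] nanophrases_count[OF assms(1), of B]
      nanophrases_count[OF assms(1), of C]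
    by (auto split: if_splits)
  have *: "Letter A \<notin> set u" "Letter B \<notin> set u" "Letter C \<notin> set u" if "u \<in> {x, y, z, t}" for u
    using that ne nanophrases_count[OF assms(1), of A] nanophrases_count[OF assms(1), of B]
      nanophrases_count[OF assms(1), of C]
    by (auto simp: count_list_0_iff)
  have [simp]: "filter (\<lambda>s. s \<noteq> Letter X) u = u" if "u \<in> {x, y, z, t}" "X \<in> {A, B, C}" for u X
    using * that by (intro filter_True) auto
  show "delete_letters {A} (?w, f) = (x @ [Letter B] @ y @ [Letter C] @ z @ [Letter B, Letter C] @ t, f)"
    "delete_letters {B} (?w, f) = (x @ [Letter A] @ y @ [Letter A, Letter C] @ z @ [Letter C] @ t, f)"
    "delete_letters {C} (?w, f) = (x @ [Letter A, Letter B] @ y @ [Letter A] @ z @ [Letter B] @ t, f)"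
    "delete_letters {A} (w', f) = (x @ [Letter B] @ y @ [Letter C] @ z @ [Letter C, Letter B] @ t, f)"
    "delete_letters {B} (w', f) = (x @ [Letter A] @ y @ [Letter C, Letter A] @ z @ [Letter C] @ t, f)"
    "delete_letters {C} (w', f) = (x @ [Letter B, Letter A] @ y @ [Letter A] @ z @ [Letter B] @ t, f)"
    using ne by (simp_all add: delete_letters_def w'_def)
qed

text \<open>
  The move only exchanges neighbours among \<open>A\<close>, \<open>B\<close>, \<open>C\<close>, which cannot be seen once just one of
  the three letters is left.
\<close>

lemma H3_site_delete_two:
  assumes "H3_site S A B C p q" "p \<in> nanophrases \<alpha> r" "D \<in> {{A, B}, {A, C}, {B, C}}"
  shows "delete_letters D p = delete_letters D q"
  using assms H3_site_distinct[OF assms(1,2)]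
  by (cases p; cases q) (auto simp: H3_site_def delete_letters_def)

lemma homotopy_step_sites:
  assumes "homotopy_step \<alpha> \<tau> S r p q"
  shows "p \<in> nanophrases \<alpha> r \<and> q \<in> nanophrases \<alpha> r \<and>
    (isomorphic p q \<or>
     (\<exists>A. H1_site A p \<and> q = delete_letters {A} p) \<or>
     (\<exists>A B. H2_site \<tau> A B p \<and> q = delete_letters {A, B} p) \<or>
     (\<exists>A B C. H3_site S A B C p q))"
  using assms
proof cases
  case (H1 x A y f)
  then have "q = delete_letters {A} p" "H1_site A p"
    by (simp only: H1_site_delete) (auto simp: H1_site_def H1)
  then show ?thesis using H1 by (auto intro: delete_letters_nanophrases)
next
  case (H2 x A B y z f)
  then have "q = delete_letters {A, B} p" "H2_site \<tau> A B p"
    by (simp only: H2_site_delete) (auto simp: H2_site_def H2)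
  then show ?thesis using H2 by (metis delete_letters_nanophrases)
next
  case (H3 x A B y C z t f)
  then have "H3_site S A B C p q"
    by (auto simp: H3_site_def)
  then show ?thesis using H3 by (metis H3_site_right_nanophrase)
qed auto

lemma hclass_H1_site:
  assumes "p \<in> nanophrases \<alpha> r" "H1_site A p"
  shows "hclass \<alpha> \<tau> S r (delete_letters {A} p) = hclass \<alpha> \<tau> S r p"
proof -
  obtain x y f where p: "p = (x @ [Letter A, Letter A] @ y, f)"
    using assms(2) by (cases p) (auto simp: H1_site_def)
  show ?thesis
    using hclass_step[OF homotopy_step.H1[OF assms(1)[unfolded p]]] H1_site_delete[OF assms(1)[unfolded p]]
    by (simp add: p)
qed

lemma hclass_H2_site:
  assumes "p \<in> nanophrases \<alpha> r" "H2_site \<tau> A B p"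
  shows "hclass \<alpha> \<tau> S r (delete_letters {A, B} p) = hclass \<alpha> \<tau> S r p"
proof -
  obtain x y z f where p: "p = (x @ [Letter A, Letter B] @ y @ [Letter B, Letter A] @ z, f)"
    and f: "f A = \<tau> (f B)"
    using assms(2) by (cases p) (auto simp: H2_site_def)
  show ?thesis
    using hclass_step[where S = S, OF homotopy_step.H2[where \<tau> = \<tau> and f = f, OF assms(1)[unfolded p] f]]
      H2_site_delete(4)[OF assms(1)[unfolded p]]
    by (simp add: p)
qed

lemma hclass_H3_site:
  assumes "p \<in> nanophrases \<alpha> r" "H3_site S A B C p q"
  shows "hclass \<alpha> \<tau> S r q = hclass \<alpha> \<tau> S r p"
proof -
  obtain x y z t f where
    p: "p = (x @ [Letter A, Letter B] @ y @ [Letter A, Letter C] @ z @ [Letter B, Letter C] @ t, f)"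
    and q: "q = (x @ [Letter B, Letter A] @ y @ [Letter C, Letter A] @ z @ [Letter C, Letter B] @ t, f)"
    and f: "(f A, f B, f C) \<in> S"
    using assms(2) by (cases p; cases q) (auto simp: H3_site_def)
  show ?thesis
    using hclass_step[where \<tau> = \<tau>, OF homotopy_step.H3[where f = f, OF assms(1)[unfolded p] f]]
    by (simp add: p q)
qed

text \<open>
  For \<open>p\<close> and \<open>q\<close> the two sides of the third move, the third relation of \<open>G\<close> reads
  \<open>H3_side p = H3_side q\<close>: each side collects the subphrases in which at least two of the three
  letters survive, with all other letters kept.
\<close>

abbreviation H3_side ::
  "('a nanophrase \<Rightarrow> 'b::ab_group_add) \<Rightarrow> nat \<Rightarrow> nat \<Rightarrow> nat \<Rightarrow> 'a nanophrase \<Rightarrow> 'b" where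
  "H3_side F A B C p \<equiv>
    F p + F (delete_letters {C} p) + F (delete_letters {B} p) + F (delete_letters {A} p)"

lemma relator_H1_site:
  assumes "p \<in> nanophrases \<alpha> r" "H1_site A p"
  shows "iclass \<alpha> r p \<in> relators \<alpha> \<tau> S r"
proof -
  obtain x y f where "p = (x @ [Letter A, Letter A] @ y, f)"
    using assms(2) by (cases p) (auto simp: H1_site_def)
  with assms show ?thesis by (auto intro: relators.R1[simplified])
qed

lemma relator_H2_site:
  assumes "p \<in> nanophrases \<alpha> r" "H2_site \<tau> A B p"
  shows "iclass \<alpha> r p + iclass \<alpha> r (delete_letters {B} p) + iclass \<alpha> r (delete_letters {A} p)
    \<in> relators \<alpha> \<tau> S r"
proof -
  obtain x y z f where p: "p = (x @ [Letter A, Letter B] @ y @ [Letter B, Letter A] @ z, f)"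
    and f: "f A = \<tau> (f B)"
    using assms(2) by (cases p) (auto simp: H2_site_def)
  note N = assms(1)[unfolded p]
  show ?thesis
    unfolding p H2_site_delete[OF N] by (rule relators.R2[where \<tau> = \<tau> and f = f, OF N f])
qed

lemma relator_H3_site:
  assumes "p \<in> nanophrases \<alpha> r" "H3_site S A B C p q"
  shows "H3_side (iclass \<alpha> r) A B C p - H3_side (iclass \<alpha> r) A B C q \<in> relators \<alpha> \<tau> S r"
proof -
  obtain x y z t f where
    p: "p = (x @ [Letter A, Letter B] @ y @ [Letter A, Letter C] @ z @ [Letter B, Letter C] @ t, f)"
    and q: "q = (x @ [Letter B, Letter A] @ y @ [Letter C, Letter A] @ z @ [Letter C, Letter B] @ t, f)"
    and f: "(f A, f B, f C) \<in> S"
    using assms(2) by (cases p; cases q) (auto simp: H3_site_def)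
  note N = assms(1)[unfolded p]
  show ?thesis
    unfolding p q H3_site_delete[OF N] by (rule relators.R3[where f = f, OF N f])
qed

lemma relators_site_cases:
  assumes "c \<in> relators \<alpha> \<tau> S r"
  obtains (H1) p A where "p \<in> nanophrases \<alpha> r" "H1_site A p" "c = iclass \<alpha> r p"
  | (H2) p A B where "p \<in> nanophrases \<alpha> r" "H2_site \<tau> A B p"
      "c = iclass \<alpha> r p + iclass \<alpha> r (delete_letters {B} p) + iclass \<alpha> r (delete_letters {A} p)"
  | (H3) p q A B C where "p \<in> nanophrases \<alpha> r" "H3_site S A B C p q"
      "c = H3_side (iclass \<alpha> r) A B C p - H3_side (iclass \<alpha> r) A B C q"
  using assms
proof cases
  case (R1 x A y f)
  then show ?thesis
    by (intro H1[of "(x @ [Letter A, Letter A] @ y, f)" A]) (auto simp: H1_site_def)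
next
  case (R2 x A B y z f)
  let ?p = "(x @ [Letter A, Letter B] @ y @ [Letter B, Letter A] @ z, f)"
  have "H2_site \<tau> A B ?p"
    using R2 by (auto simp: H2_site_def)
  then show ?thesis
    by (rule H2[OF R2(2)]) (simp only: R2(1) H2_site_delete[OF R2(2)])
next
  case (R3 x A B y C z t f)
  let ?p = "(x @ [Letter A, Letter B] @ y @ [Letter A, Letter C] @ z @ [Letter B, Letter C] @ t, f)"
  let ?q = "(x @ [Letter B, Letter A] @ y @ [Letter C, Letter A] @ z @ [Letter C, Letter B] @ t, f)"
  have "H3_site S A B C ?p ?q"
    using R3 by (auto simp: H3_site_def)
  then show ?thesis
    by (rule H3[OF R3(2)]) (simp only: R3(1) H3_site_delete[OF R3(2)])
qed

section \<open>Sums over deletions\<close>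

text \<open>
  For \<open>e = 1\<close> and \<open>X\<close> the set of all letters this is the subphrase sum; for \<open>e = - 1\<close> it is the
  expansion of the phrase with semi-letters \<open>X\<close>. The weight \<open>e\<close> lets both share one recursion.
\<close>

definition deletion_sum ::
  "int \<Rightarrow> ('a nanophrase \<Rightarrow> ('b \<Rightarrow>\<^sub>0 int)) \<Rightarrow> nat set \<Rightarrow> 'a nanophrase \<Rightarrow> ('b \<Rightarrow>\<^sub>0 int)" where
  "deletion_sum e F X p = (\<Sum>D\<in>Pow X. frag_cmul (e ^ card D) (F (delete_letters D p)))"

lemma deletion_sum_empty [simp]: "deletion_sum e F {} p = F p"
  by (simp add: deletion_sum_def)

lemma sum_Pow_insert:
  assumes "finite X" "A \<notin> X"
  shows "(\<Sum>D\<in>Pow (insert A X). g D) = (\<Sum>D\<in>Pow X. g D) + (\<Sum>D\<in>Pow X. g (insert A D))"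
proof -
  have "inj_on (insert A) (Pow X)"
    using assms(2) by (auto simp: inj_on_def)
  moreover have "Pow X \<inter> insert A ` Pow X = {}"
    using assms(2) by auto
  ultimately show ?thesis
    using assms(1) by (simp add: Pow_insert sum.union_disjoint sum.reindex)
qed

text \<open>
  The deleted sets without \<open>A\<close> give the first summand, those with \<open>A\<close> the second. For \<open>e = - 1\<close>
  this is the defining recursion of semi-letters.
\<close>

lemma deletion_sum_insert:
  assumes "finite X" "A \<notin> X"
  shows "deletion_sum e F (insert A X) p =
    deletion_sum e F X p + frag_cmul e (deletion_sum e F X (delete_letters {A} p))"
proof -
  have "frag_cmul (e ^ card (insert A D)) (F (delete_letters (insert A D) p)) =
      frag_cmul e (frag_cmul (e ^ card D) (F (delete_letters D (delete_letters {A} p))))"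
    if "D \<in> Pow X" for D
  proof -
    have "finite D" "A \<notin> D"
      using that assms finite_subset by auto
    then show ?thesis
      by (simp add: delete_letters_delete_letters)
  qed
  then show ?thesis
    unfolding deletion_sum_def sum_Pow_insert[OF assms] frag_cmul_sum by simp
qed

lemma deletion_sum_cong:
  "(\<And>D. D \<subseteq> X \<Longrightarrow> F (delete_letters D p) = F (delete_letters D q)) \<Longrightarrow>
    deletion_sum e F X p = deletion_sum e F X q"
  unfolding deletion_sum_def by (rule sum.cong) auto

lemma deletion_sum_isomorphic:
  assumes F: "\<And>p q. p \<in> nanophrases \<alpha> r \<Longrightarrow> q \<in> nanophrases \<alpha> r \<Longrightarrow> isomorphic p q \<Longrightarrow> F p = F q"
    and "p \<in> nanophrases \<alpha> r" "q \<in> nanophrases \<alpha> r" "isomorphic p q"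
  shows "deletion_sum e F (letters (fst p)) p = deletion_sum e F (letters (fst q)) q"
proof -
  obtain \<sigma> where b: "bij_betw \<sigma> (letters (fst p)) (letters (fst q))"
    and v: "\<forall>A\<in>letters (fst p). snd q (\<sigma> A) = snd p A"
    and w: "fst q = map (map_symbol \<sigma>) (fst p)"
    using assms(4) by (auto simp: isomorphic_def)
  have "F (delete_letters D p) = F (delete_letters (\<sigma> ` D) q) \<and> card D = card (\<sigma> ` D)"
    if "D \<in> Pow (letters (fst p))" for D
  proof
    show "F (delete_letters D p) = F (delete_letters (\<sigma> ` D) q)"
      using isomorphic_delete_letters[OF b v w] that assms(2,3)
      by (intro F delete_letters_nanophrases) auto
    show "card D = card (\<sigma> ` D)"
      using b that by (metis PowD bij_betw_def card_image inj_on_subset)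
  qed
  then have "deletion_sum e F (letters (fst p)) p =
      (\<Sum>D\<in>Pow (letters (fst p)). frag_cmul (e ^ card (\<sigma> ` D)) (F (delete_letters (\<sigma> ` D) q)))"
    unfolding deletion_sum_def by (intro sum.cong refl) metis
  also have "\<dots> = deletion_sum e F (letters (fst q)) q"
    unfolding deletion_sum_def by (rule sum.reindex_bij_betw[OF bij_betw_Pow[OF b]])
  finally show ?thesis .
qed

text \<open>
  Inclusion and exclusion: \<open>xAyAz\<close> is the sum of the phrase in which \<open>A\<close> is a semi-letter and the
  phrase in which \<open>A\<close> is deleted. Doing this for every letter of \<open>X\<close> writes \<open>p\<close> as the sum, over
  all \<open>D\<close>, of the phrases in which \<open>D\<close> is deleted and \<open>X - D\<close> consists of semi-letters.
\<close>

lemma deletion_sum_inversion: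
  assumes "finite X"
  shows "(\<Sum>D\<in>Pow X. deletion_sum (- 1) F (X - D) (delete_letters D p)) = F p"
  using assms
proof (induction X arbitrary: p)
  case (insert A X)
  have "(\<Sum>D\<in>Pow (insert A X). deletion_sum (- 1) F (insert A X - D) (delete_letters D p)) =
      (\<Sum>D\<in>Pow X. deletion_sum (- 1) F (insert A (X - D)) (delete_letters D p)) +
      (\<Sum>D\<in>Pow X. deletion_sum (- 1) F (X - D) (delete_letters D (delete_letters {A} p)))"
    unfolding sum_Pow_insert[OF insert(1,2)]
    using insert(2)
    by (intro arg_cong2[where f = "(+)"] sum.cong refl arg_cong2[where f = "deletion_sum _ _"])
      (auto simp: delete_letters_delete_letters)
  also have "(\<Sum>D\<in>Pow X. deletion_sum (- 1) F (insert A (X - D)) (delete_letters D p)) =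
      (\<Sum>D\<in>Pow X. deletion_sum (- 1) F (X - D) (delete_letters D p)) -
      (\<Sum>D\<in>Pow X. deletion_sum (- 1) F (X - D) (delete_letters D (delete_letters {A} p)))"
    using insert(1,2)
    by (simp add: deletion_sum_insert sum_subtractf delete_letters_commute[of "{A}"])
  finally show ?case
    by (simp add: insert.IH)
qed simp

lemma subphrase_sum_eq: "subphrase_sum \<alpha> r p = deletion_sum 1 (iclass \<alpha> r) (letters (fst p)) p"
  by (simp add: subphrase_sum_def deletion_sum_def)

lemma semi_eq_deletion_sum:
  "distinct As \<Longrightarrow> semi \<alpha> \<tau> S r As p = deletion_sum (- 1) (hclass \<alpha> \<tau> S r) (set As) p"
  by (induction As arbitrary: p) (simp_all add: deletion_sum_insert)

text \<open>
  This element is defined by the sum over subsets, not by \<^const>\<open>semi\<close>, to avoid choosing an order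
  of the letters.
\<close>

definition all_semi ::
  "'a set \<Rightarrow> ('a \<Rightarrow> 'a) \<Rightarrow> ('a \<times> 'a \<times> 'a) set \<Rightarrow> nat \<Rightarrow> 'a nanophrase \<Rightarrow>
   ('a nanophrase set \<Rightarrow>\<^sub>0 int)" where
  "all_semi \<alpha> \<tau> S r p = deletion_sum (- 1) (hclass \<alpha> \<tau> S r) (letters (fst p)) p"

lemma all_semi_eq_semi:
  "all_semi \<alpha> \<tau> S r p = semi \<alpha> \<tau> S r (sorted_list_of_set (letters (fst p))) p"
  by (simp add: all_semi_def semi_eq_deletion_sum)

lemma all_semi_isomorphic:
  "p \<in> nanophrases \<alpha> r \<Longrightarrow> q \<in> nanophrases \<alpha> r \<Longrightarrow> isomorphic p q \<Longrightarrow>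
    all_semi \<alpha> \<tau> S r p = all_semi \<alpha> \<tau> S r q"
  unfolding all_semi_def
  by (rule deletion_sum_isomorphic) (auto intro: hclass_step homotopy_step.iso)

lemma subphrase_sum_isomorphic:
  "p \<in> nanophrases \<alpha> r \<Longrightarrow> q \<in> nanophrases \<alpha> r \<Longrightarrow> isomorphic p q \<Longrightarrow>
    subphrase_sum \<alpha> r p = subphrase_sum \<alpha> r q"
  unfolding subphrase_sum_eq by (rule deletion_sum_isomorphic) (auto intro: iclass_isomorphic)

lemma sum_all_semi_subphrases:
  "(\<Sum>D\<in>Pow (letters (fst p)). all_semi \<alpha> \<tau> S r (delete_letters D p)) = hclass \<alpha> \<tau> S r p"
  using deletion_sum_inversion[of "letters (fst p)" "hclass \<alpha> \<tau> S r" p] by (simp add: all_semi_def)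

section \<open>The relations hold for phrases with only semi-letters\<close>

lemma letters_H1_site:
  assumes "H1_site A p" shows "letters (fst p) = insert A (letters (fst p) - {A})"
  using assms by (auto simp: H1_site_def letters_def)

lemma letters_H2_site:
  assumes "H2_site \<tau> A B p"
  shows "letters (fst p) = insert A (insert B (letters (fst p) - {A, B}))"
  using assms by (auto simp: H2_site_def letters_def)

lemma letters_H3_site:
  assumes "H3_site S A B C p q"
  shows "letters (fst p) = insert A (insert B (insert C (letters (fst p) - {A, B, C})))"
    and "letters (fst q) = letters (fst p)"
  using assms by (auto simp: H3_site_def letters_def)

text \<open>
  The letter \<open>A\<close> as a semi-letter gives the difference of the two sides of the move; the remaining
  semi-letters do not interfere, because the move is still possible after deleting any of them.
\<close>

lemma all_semi_H1_site:
  assumes "p \<in> nanophrases \<alpha> r" "H1_site A p"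
  shows "all_semi \<alpha> \<tau> S r p = 0"
proof -
  let ?L = "letters (fst p) - {A}"
  have "deletion_sum (- 1) (hclass \<alpha> \<tau> S r) ?L (delete_letters {A} p) =
      deletion_sum (- 1) (hclass \<alpha> \<tau> S r) ?L p"
    using assms
    by (intro deletion_sum_cong, subst delete_letters_commute)
      (auto intro!: hclass_H1_site H1_site_delete_letters delete_letters_nanophrases)
  then show ?thesis
    unfolding all_semi_def by (subst letters_H1_site[OF assms(2)])
      (simp add: deletion_sum_insert del: insert_Diff_single)
qed

text \<open>
  Let \<open>s\<close> denote the expansion in the letters outside the site. With \<open>p\<^sub>A\<close>, \<open>p\<^sub>B\<close>, \<open>p\<^sub>0\<close> the phrases
  in which only \<open>A\<close>, only \<open>B\<close>, or neither is kept, the three terms are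
  \<open>s(p) - s(p\<^sub>A) - s(p\<^sub>B) + s(p\<^sub>0)\<close>, \<open>s(p\<^sub>A) - s(p\<^sub>0)\<close> and \<open>s(p\<^sub>B) - s(p\<^sub>0)\<close>. Their sum is
  \<open>s(p) - s(p\<^sub>0)\<close>, which vanishes by the move.
\<close>

lemma all_semi_H2_site:
  assumes "p \<in> nanophrases \<alpha> r" "H2_site \<tau> A B p" "A \<noteq> B"
  shows "all_semi \<alpha> \<tau> S r p + all_semi \<alpha> \<tau> S r (delete_letters {B} p) +
    all_semi \<alpha> \<tau> S r (delete_letters {A} p) = 0"
proof -
  let ?L = "letters (fst p) - {A, B}" and ?s = "deletion_sum (- 1) (hclass \<alpha> \<tau> S r)"
  have *: "?s ?L (delete_letters {A, B} p) = ?s ?L p"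
    using assms
    by (intro deletion_sum_cong, subst delete_letters_commute)
      (auto intro!: hclass_H2_site H2_site_delete_letters delete_letters_nanophrases)
  have L: "letters (fst p) = insert A (insert B ?L)" "letters (fst p) - {B} = insert A ?L"
     "letters (fst p) - {A} = insert B ?L"
    using letters_H2_site[OF assms(2)] assms(3) by auto
  have "all_semi \<alpha> \<tau> S r p = ?s ?L p - ?s ?L (delete_letters {B} p)
      - (?s ?L (delete_letters {A} p) - ?s ?L (delete_letters {A, B} p))"
    unfolding all_semi_def using assms(3)
    by (subst L(1)) (simp add: deletion_sum_insert delete_letters_delete_letters insert_commute)
  moreover have "all_semi \<alpha> \<tau> S r (delete_letters {B} p) =
      ?s ?L (delete_letters {B} p) - ?s ?L (delete_letters {A, B} p)"
    unfolding all_semi_def letters_delete_letters L(2)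
    by (simp add: deletion_sum_insert delete_letters_delete_letters insert_commute)
  moreover have "all_semi \<alpha> \<tau> S r (delete_letters {A} p) =
      ?s ?L (delete_letters {A} p) - ?s ?L (delete_letters {A, B} p)"
    unfolding all_semi_def letters_delete_letters L(3)
    by (simp add: deletion_sum_insert delete_letters_delete_letters insert_commute)
  ultimately show ?thesis
    using * by simp
qed

text \<open>
  The terms in which two of the letters \<open>A\<close>, \<open>B\<close>, \<open>C\<close> are kept cancel. What is left is \<open>p\<close> itself,
  which the third move respects, and phrases keeping at most one of the letters, which are
  literally the same on both sides of the move.
\<close>

lemma all_semi_H3_expansion:
  fixes p :: "'a nanophrase" and \<alpha> :: "'a set" and \<tau> :: "'a \<Rightarrow> 'a"
    and S :: "('a \<times> 'a \<times> 'a) set" and r :: nat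
  assumes "A \<noteq> B" "A \<noteq> C" "B \<noteq> C" "{A, B, C} \<subseteq> letters (fst p)"
  defines "L \<equiv> letters (fst p) - {A, B, C}" and "s \<equiv> deletion_sum (- 1) (hclass \<alpha> \<tau> S r)"
  shows "H3_side (all_semi \<alpha> \<tau> S r) A B C p =
    s L p - s L (delete_letters {B, C} p) - s L (delete_letters {A, C} p)
      - s L (delete_letters {A, B} p) + s L (delete_letters {A, B, C} p)
      + s L (delete_letters {A, B, C} p)"
proof -
  have L: "letters (fst p) = insert A (insert B (insert C L))"
      "letters (fst p) - {C} = insert A (insert B L)"
      "letters (fst p) - {B} = insert A (insert C L)"
      "letters (fst p) - {A} = insert B (insert C L)"
    using assms(1-4) by (auto simp: L_def)
  have fin: "finite L" "A \<notin> L" "B \<notin> L" "C \<notin> L"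
    by (auto simp: L_def)
  have ins: "insert B {A} = {A, B}" "insert C {A} = {A, C}" "insert C {B} = {B, C}"
      "insert C {A, B} = {A, B, C}" "insert B {A, C} = {A, B, C}"
    by auto
  have 1: "all_semi \<alpha> \<tau> S r p = s L p - s L (delete_letters {C} p)
      - (s L (delete_letters {B} p) - s L (delete_letters {B, C} p))
      - (s L (delete_letters {A} p) - s L (delete_letters {A, C} p)
        - (s L (delete_letters {A, B} p) - s L (delete_letters {A, B, C} p)))"
    unfolding all_semi_def s_def[symmetric] using assms(1-3) fin
    by (subst L(1)) (simp add: deletion_sum_insert s_def delete_letters_delete_letters ins)
  have 2: "all_semi \<alpha> \<tau> S r (delete_letters {C} p) =
      s L (delete_letters {C} p) - s L (delete_letters {B, C} p)
      - (s L (delete_letters {A, C} p) - s L (delete_letters {A, B, C} p))"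
    unfolding all_semi_def letters_delete_letters L(2) using assms(1-3) fin
    by (simp add: deletion_sum_insert s_def delete_letters_delete_letters insert_commute)
  have 3: "all_semi \<alpha> \<tau> S r (delete_letters {B} p) =
      s L (delete_letters {B} p) - s L (delete_letters {B, C} p)
      - (s L (delete_letters {A, B} p) - s L (delete_letters {A, B, C} p))"
    unfolding all_semi_def letters_delete_letters L(3) using assms(1-3) fin
    by (simp add: deletion_sum_insert s_def delete_letters_delete_letters insert_commute)
  have 4: "all_semi \<alpha> \<tau> S r (delete_letters {A} p) =
      s L (delete_letters {A} p) - s L (delete_letters {A, C} p)
      - (s L (delete_letters {A, B} p) - s L (delete_letters {A, B, C} p))"
    unfolding all_semi_def letters_delete_letters L(4) using assms(1-3) fin
    by (simp add: deletion_sum_insert s_def delete_letters_delete_letters insert_commute)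
  show ?thesis
    unfolding 1 2 3 4 by (simp add: algebra_simps)
qed

lemma all_semi_H3_site:
  assumes "p \<in> nanophrases \<alpha> r" "H3_site S A B C p q"
  shows "H3_side (all_semi \<alpha> \<tau> S r) A B C p =
    H3_side (all_semi \<alpha> \<tau> S r) A B C q"
proof -
  note ne = H3_site_distinct[OF assms(2,1)]
  have L: "{A, B, C} \<subseteq> letters (fst p)" "{A, B, C} \<subseteq> letters (fst q)"
    using letters_H3_site[OF assms(2)] by auto
  note two = H3_site_delete_two[OF assms(2,1)]
  have three: "delete_letters {A, B, C} p = delete_letters {A, B, C} q"
    using two[of "{B, C}"] delete_letters_delete_letters[of "{A}" "{B, C}"]
    by (metis insert_is_Un insertCI)
  have "deletion_sum (- 1) (hclass \<alpha> \<tau> S r) (letters (fst p) - {A, B, C}) p =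
      deletion_sum (- 1) (hclass \<alpha> \<tau> S r) (letters (fst p) - {A, B, C}) q"
    by (intro deletion_sum_cong hclass_H3_site[symmetric, where A = A and B = B and C = C]
      H3_site_delete_letters[OF assms(2)] delete_letters_nanophrases assms(1)) auto
  then show ?thesis
    unfolding all_semi_H3_expansion[OF ne L(1)] all_semi_H3_expansion[OF ne L(2)]
      letters_H3_site(2)[OF assms(2)]
    by (simp add: two three)
qed

section \<open>The quotient groups\<close>

lemma hom_free_Abelian_group_eqI:
  assumes "group G" "h \<in> hom (free_Abelian_group X) G" "k \<in> hom (free_Abelian_group X) G"
    and "\<And>x. x \<in> X \<Longrightarrow> h (frag_of x) = k (frag_of x)"
    and "c \<in> carrier (free_Abelian_group X)"
  shows "h c = k c"
proof -
  interpret h: group_hom "free_Abelian_group X" G h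
    using assms(1,2) by (simp add: group_hom_def group_hom_axioms_def)
  interpret k: group_hom "free_Abelian_group X" G k
    using assms(1,3) by (simp add: group_hom_def group_hom_axioms_def)
  have "Poly_Mapping.keys c \<subseteq> X"
    using assms(5) by simp
  then show ?thesis
  proof (induction c rule: free_Abelian_group_induct[consumes 1, case_names zero diff one])
    case zero
    then show ?case using h.hom_one k.hom_one by simp
  next
    case (diff x y)
    then show ?case
      using h.hom_mult[of x "- y"] k.hom_mult[of x "- y"] h.hom_inv[of y] k.hom_inv[of y] by simp
  next
    case (one a)
    then show ?case by (rule assms(4))
  qed
qed

text \<open>
  The generated subgroup is normal because \<open>G\<close> is abelian, and it lies in the kernel as soon as its
  generators do.
\<close>

lemma (in group_hom) factor_Mod_generate:
  assumes "comm_group G" "K \<subseteq> carrier G" "\<And>k. k \<in> K \<Longrightarrow> h k = \<one>\<^bsub>H\<^esub>"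
  obtains g where "g \<in> hom (G Mod generate G K) H"
    "\<And>x. x \<in> carrier G \<Longrightarrow> g (generate G K #>\<^bsub>G\<^esub> x) = h x"
proof (rule FactGroup_universal_kernel)
  show "generate G K \<lhd> G"
    using assms(1,2) by (simp add: comm_group.subgroup_imp_normal G.generate_is_subgroup)
  show "generate G K \<subseteq> kernel G H h"
    using assms(2,3) by (intro G.generate_subgroup_incl subgroup_kernel) (auto simp: kernel_def)
qed (use that in blast)

lemma (in group) coset_eq_iff:
  assumes "subgroup N G" "x \<in> carrier G" "y \<in> carrier G"
  shows "N #> x = N #> y \<longleftrightarrow> x \<otimes> inv y \<in> N"
  using assms by (metis repr_independence repr_independenceD subgroup.rcos_module is_group)

lemma iclass_closed: "p \<in> nanophrases \<alpha> r \<Longrightarrow> iclass \<alpha> r p \<in> carrier (ZI \<alpha> r)"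
  by (simp add: iclass_def ZI_def quotientI)

lemma hclass_closed: "p \<in> nanophrases \<alpha> r \<Longrightarrow> hclass \<alpha> \<tau> S r p \<in> carrier (ZP \<alpha> \<tau> S r)"
  by (simp add: hclass_def ZP_def homotopy_classes_def quotientI)

lemma comm_group_ZI: "comm_group (ZI \<alpha> r)"
  by (simp add: ZI_def abelian_free_Abelian_group)

lemma group_ZI: "group (ZI \<alpha> r)"
  by (simp add: ZI_def)

lemma ZI_simps [simp]:
  "\<one>\<^bsub>ZI \<alpha> r\<^esub> = 0" "x \<otimes>\<^bsub>ZI \<alpha> r\<^esub> y = x + y"
  "x \<in> carrier (ZI \<alpha> r) \<Longrightarrow> inv\<^bsub>ZI \<alpha> r\<^esub> x = - x"
  by (simp_all add: ZI_def)

text \<open>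
  Stated with the operations of the type instead of those of the group record, so that the
  identities between sums above apply directly.
\<close>

lemma subgroup_ZI_closed:
  assumes "subgroup H (ZI \<alpha> r)"
  shows "0 \<in> H" "x \<in> H \<Longrightarrow> y \<in> H \<Longrightarrow> x + y \<in> H" "x \<in> H \<Longrightarrow> - x \<in> H"
    "x \<in> H \<Longrightarrow> y \<in> H \<Longrightarrow> x - y \<in> H" "(\<And>i. i \<in> I \<Longrightarrow> f i \<in> H) \<Longrightarrow> sum f I \<in> H"
proof -
  show 0: "0 \<in> H"
    using subgroup.one_closed[OF assms] by simp
  show add: "x + y \<in> H" if "x \<in> H" "y \<in> H" for x y
    using subgroup.m_closed[OF assms that] by simp
  show uminus: "- x \<in> H" if "x \<in> H" for x
    using subgroup.m_inv_closed[OF assms that] subgroup.mem_carrier[OF assms that] by simp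
  show "x - y \<in> H" if "x \<in> H" "y \<in> H" for x y
    using add[OF that(1) uminus[OF that(2)]] by simp
  show "sum f I \<in> H" if "\<And>i. i \<in> I \<Longrightarrow> f i \<in> H"
    using that by (induction I rule: infinite_finite_induct) (auto intro: 0 add)
qed

lemmas ZI_closed = subgroup_ZI_closed[OF group.subgroup_self[OF group_ZI]]

lemma relators_subset: "relators \<alpha> \<tau> S r \<subseteq> carrier (ZI \<alpha> r)"
proof
  fix c assume "c \<in> relators \<alpha> \<tau> S r"
  then show "c \<in> carrier (ZI \<alpha> r)"
    by (cases rule: relators_site_cases)
      (auto intro!: ZI_closed iclass_closed delete_letters_nanophrases
        intro: H3_site_right_nanophrase)
qed

lemma subgroup_relator_subgroup: "subgroup (relator_subgroup \<alpha> \<tau> S r) (ZI \<alpha> r)"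
  unfolding relator_subgroup_def by (intro group.generate_is_subgroup group_ZI relators_subset)

lemmas relator_subgroup_closed = subgroup_ZI_closed[OF subgroup_relator_subgroup]

lemma relators_in_relator_subgroup: "c \<in> relators \<alpha> \<tau> S r \<Longrightarrow> c \<in> relator_subgroup \<alpha> \<tau> S r"
  unfolding relator_subgroup_def by (rule generate.incl)

lemma comm_group_G_grp: "comm_group (G_grp \<alpha> \<tau> S r)"
  unfolding G_grp_def
  by (intro comm_group.abelian_FactGroup comm_group_ZI subgroup_relator_subgroup)

lemma G_proj_hom: "G_proj \<alpha> \<tau> S r \<in> hom (ZI \<alpha> r) (G_grp \<alpha> \<tau> S r)"
  unfolding G_grp_def G_proj_def
  by (intro normal.r_coset_hom_Mod comm_group.subgroup_imp_normal comm_group_ZI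
      subgroup_relator_subgroup)

lemma G_proj_surj: "X \<in> carrier (G_grp \<alpha> \<tau> S r) \<Longrightarrow> \<exists>c\<in>carrier (ZI \<alpha> r). X = G_proj \<alpha> \<tau> S r c"
  by (auto simp: G_grp_def G_proj_def FactGroup_def RCOSETS_def)

lemma G_proj_eq:
  "x \<in> carrier (ZI \<alpha> r) \<Longrightarrow> y \<in> carrier (ZI \<alpha> r) \<Longrightarrow> x - y \<in> relator_subgroup \<alpha> \<tau> S r \<Longrightarrow>
    G_proj \<alpha> \<tau> S r x = G_proj \<alpha> \<tau> S r y"
  unfolding G_proj_def
  by (subst group.coset_eq_iff[OF group_ZI subgroup_relator_subgroup]) simp_all

definition high_rank_classes ::
  "nat \<Rightarrow> 'a set \<Rightarrow> ('a \<Rightarrow> 'a) \<Rightarrow> ('a \<times> 'a \<times> 'a) set \<Rightarrow> nat \<Rightarrow> ('a nanophrase set \<Rightarrow>\<^sub>0 int) set set"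
  where "high_rank_classes n \<alpha> \<tau> S r =
    {G_proj \<alpha> \<tau> S r (iclass \<alpha> r p) | p. p \<in> nanophrases \<alpha> r \<and> rank p > n}"

lemma high_rank_classes_subset: "high_rank_classes n \<alpha> \<tau> S r \<subseteq> carrier (G_grp \<alpha> \<tau> S r)"
  using hom_in_carrier[OF G_proj_hom iclass_closed] unfolding high_rank_classes_def by blast

lemma high_rank_subgroup_eq:
  "high_rank_subgroup n \<alpha> \<tau> S r = generate (G_grp \<alpha> \<tau> S r) (high_rank_classes n \<alpha> \<tau> S r)"
  by (simp add: high_rank_subgroup_def high_rank_classes_def)

lemma subgroup_high_rank_subgroup: "subgroup (high_rank_subgroup n \<alpha> \<tau> S r) (G_grp \<alpha> \<tau> S r)"
  unfolding high_rank_subgroup_eq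
  by (intro group.generate_is_subgroup high_rank_classes_subset comm_group.axioms(2) comm_group_G_grp)

lemma comm_group_Gn: "comm_group (Gn n \<alpha> \<tau> S r)"
  unfolding Gn_def
  by (intro comm_group.abelian_FactGroup comm_group_G_grp subgroup_high_rank_subgroup)

lemma Gn_proj_hom: "Gn_proj n \<alpha> \<tau> S r \<in> hom (G_grp \<alpha> \<tau> S r) (Gn n \<alpha> \<tau> S r)"
  unfolding Gn_def Gn_proj_def
  by (intro normal.r_coset_hom_Mod comm_group.subgroup_imp_normal comm_group_G_grp
      subgroup_high_rank_subgroup)

lemma Gn_proj_high_rank:
  assumes "p \<in> nanophrases \<alpha> r" "rank p > n"
  shows "Gn_proj n \<alpha> \<tau> S r (G_proj \<alpha> \<tau> S r (iclass \<alpha> r p)) = \<one>\<^bsub>Gn n \<alpha> \<tau> S r\<^esub>"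
proof -
  have m: "G_proj \<alpha> \<tau> S r (iclass \<alpha> r p) \<in> high_rank_subgroup n \<alpha> \<tau> S r"
    unfolding high_rank_subgroup_def using assms by (intro generate.incl) blast
  show ?thesis
    unfolding Gn_proj_def Gn_def one_FactGroup
    by (intro group.coset_join2 comm_group.axioms(2) comm_group_G_grp subgroup_high_rank_subgroup m
        subgroup.mem_carrier[OF subgroup_high_rank_subgroup m])
qed

section \<open>Homotopy invariance of the subphrase sum\<close>

text \<open>
  The subphrases that lack \<open>A\<close> are those of the right-hand side of the move; each of the others is a relator.
\<close>

lemma subphrase_sum_H1_site:
  assumes "p \<in> nanophrases \<alpha> r" "H1_site A p"
  shows "subphrase_sum \<alpha> r p - subphrase_sum \<alpha> r (delete_letters {A} p) \<in> relator_subgroup \<alpha> \<tau> S r"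
proof -
  let ?L = "letters (fst p) - {A}"
  have "subphrase_sum \<alpha> r p - subphrase_sum \<alpha> r (delete_letters {A} p) =
      deletion_sum 1 (iclass \<alpha> r) ?L p"
    unfolding subphrase_sum_eq
    by (subst letters_H1_site[OF assms(2)])
      (simp add: deletion_sum_insert del: insert_Diff_single)
  also have "\<dots> = (\<Sum>D\<in>Pow ?L. iclass \<alpha> r (delete_letters D p))"
    by (simp add: deletion_sum_def)
  also have "\<dots> \<in> relator_subgroup \<alpha> \<tau> S r"
  proof (rule relator_subgroup_closed)
    fix D assume "D \<in> Pow ?L"
    then have "H1_site A (delete_letters D p)"
      using assms(2) by (auto intro: H1_site_delete_letters)
    then show "iclass \<alpha> r (delete_letters D p) \<in> relator_subgroup \<alpha> \<tau> S r"
      using delete_letters_nanophrases[OF assms(1)]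
      by (intro relators_in_relator_subgroup relator_H1_site)
  qed
  finally show ?thesis .
qed

text \<open>
  For fixed \<open>D\<close> outside the site, the subphrases that keep at least one of \<open>A\<close>, \<open>B\<close> add up to a
  relator, and the one that keeps neither is a subphrase of the right-hand side
  of the move.
\<close>

lemma subphrase_sum_H2_site:
  assumes "p \<in> nanophrases \<alpha> r" "H2_site \<tau> A B p" "A \<noteq> B"
  shows "subphrase_sum \<alpha> r p - subphrase_sum \<alpha> r (delete_letters {A, B} p)
    \<in> relator_subgroup \<alpha> \<tau> S r"
proof -
  let ?L = "letters (fst p) - {A, B}" and ?s = "deletion_sum 1 (iclass \<alpha> r)"
  have "subphrase_sum \<alpha> r p - subphrase_sum \<alpha> r (delete_letters {A, B} p) =
      ?s ?L p + ?s ?L (delete_letters {B} p) + ?s ?L (delete_letters {A} p)"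
    unfolding subphrase_sum_eq using assms(3)
    by (subst letters_H2_site[OF assms(2)])
      (simp add: deletion_sum_insert delete_letters_delete_letters insert_commute)
  also have "\<dots> = (\<Sum>D\<in>Pow ?L. iclass \<alpha> r (delete_letters D p)
      + iclass \<alpha> r (delete_letters {B} (delete_letters D p))
      + iclass \<alpha> r (delete_letters {A} (delete_letters D p)))"
    by (simp add: deletion_sum_def sum.distrib delete_letters_delete_letters insert_commute Un_commute)
  also have "\<dots> \<in> relator_subgroup \<alpha> \<tau> S r"
  proof (rule relator_subgroup_closed)
    fix D assume "D \<in> Pow ?L"
    then have "H2_site \<tau> A B (delete_letters D p)"
      using assms(2) by (auto intro: H2_site_delete_letters)
    then show "iclass \<alpha> r (delete_letters D p)
        + iclass \<alpha> r (delete_letters {B} (delete_letters D p))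
        + iclass \<alpha> r (delete_letters {A} (delete_letters D p)) \<in> relator_subgroup \<alpha> \<tau> S r"
      using delete_letters_nanophrases[OF assms(1)]
      by (intro relators_in_relator_subgroup relator_H2_site)
  qed
  finally show ?thesis .
qed

text \<open>
  The eight ways to treat \<open>A\<close>, \<open>B\<close>, \<open>C\<close>, split into the four that occur in the relation and the
  four that agree on both sides of the move. In the last summand all three letters are deleted in
  two steps, so that equality on both sides follows from \<open>H3_site_delete_two\<close>.
\<close>

lemma subphrase_sum_H3_expansion:
  fixes p :: "'a nanophrase"
  assumes "A \<noteq> B" "A \<noteq> C" "B \<noteq> C" "{A, B, C} \<subseteq> letters (fst p)"
  shows "subphrase_sum \<alpha> r p = (\<Sum>D\<in>Pow (letters (fst p) - {A, B, C}).
    H3_side (iclass \<alpha> r) A B C (delete_letters D p)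
    + (iclass \<alpha> r (delete_letters D (delete_letters {B, C} p))
      + iclass \<alpha> r (delete_letters D (delete_letters {A, C} p))
      + iclass \<alpha> r (delete_letters D (delete_letters {A, B} p))
      + iclass \<alpha> r (delete_letters D (delete_letters {B, C} (delete_letters {A} p)))))"
proof -
  let ?L = "letters (fst p) - {A, B, C}"
  have L: "letters (fst p) = insert A (insert B (insert C ?L))"
    using assms(4) by auto
  show ?thesis
    unfolding subphrase_sum_eq using assms(1-3)
    by (subst L) (simp add: deletion_sum_insert, simp add: deletion_sum_def sum.distrib
        delete_letters_delete_letters insert_commute Un_commute)
qed

lemma subphrase_sum_H3_site:
  assumes "p \<in> nanophrases \<alpha> r" "H3_site S A B C p q"
  shows "subphrase_sum \<alpha> r p - subphrase_sum \<alpha> r q \<in> relator_subgroup \<alpha> \<tau> S r"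
proof -
  let ?L = "letters (fst p) - {A, B, C}"
  note ne = H3_site_distinct[OF assms(2,1)]
  have L: "{A, B, C} \<subseteq> letters (fst p)" "{A, B, C} \<subseteq> letters (fst q)"
    using letters_H3_site[OF assms(2)] by auto
  note two = H3_site_delete_two[OF assms(2,1)]
  have three: "delete_letters {B, C} (delete_letters {A} p) = delete_letters {B, C} (delete_letters {A} q)"
    using two[of "{B, C}"]
    by (simp only: delete_letters_commute[of "{B, C}" "{A}"] insert_iff simp_thms)
  have "subphrase_sum \<alpha> r p - subphrase_sum \<alpha> r q = (\<Sum>D\<in>Pow ?L.
      H3_side (iclass \<alpha> r) A B C (delete_letters D p)
      - H3_side (iclass \<alpha> r) A B C (delete_letters D q))"
    unfolding subphrase_sum_H3_expansion[OF ne L(1)] subphrase_sum_H3_expansion[OF ne L(2)]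
      letters_H3_site(2)[OF assms(2)]
    by (simp add: two three flip: sum_subtractf)
  also have "\<dots> \<in> relator_subgroup \<alpha> \<tau> S r"
  proof (rule relator_subgroup_closed)
    fix D assume "D \<in> Pow ?L"
    then have "H3_site S A B C (delete_letters D p) (delete_letters D q)"
      using assms(2) by (auto intro: H3_site_delete_letters)
    then show "H3_side (iclass \<alpha> r) A B C (delete_letters D p)
      - H3_side (iclass \<alpha> r) A B C (delete_letters D q) \<in> relator_subgroup \<alpha> \<tau> S r"
      using delete_letters_nanophrases[OF assms(1)]
      by (intro relators_in_relator_subgroup relator_H3_site)
  qed
  finally show ?thesis .
qed

lemma subphrase_sum_step:
  assumes "homotopy_step \<alpha> \<tau> S r p q"
  shows "subphrase_sum \<alpha> r p - subphrase_sum \<alpha> r q \<in> relator_subgroup \<alpha> \<tau> S r"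
proof -
  have N: "p \<in> nanophrases \<alpha> r" "q \<in> nanophrases \<alpha> r"
    using homotopy_step_sites[OF assms] by auto
  from homotopy_step_sites[OF assms] consider "isomorphic p q"
    | A where "H1_site A p" "q = delete_letters {A} p"
    | A B where "H2_site \<tau> A B p" "q = delete_letters {A, B} p"
    | A B C where "H3_site S A B C p q"
    by blast
  then show ?thesis
  proof cases
    case 1
    then show ?thesis
      using subphrase_sum_isomorphic[OF N] relator_subgroup_closed(1) by simp
  next
    case 2
    then show ?thesis using subphrase_sum_H1_site[OF N(1)] by simp
  next
    case 3
    then show ?thesis using subphrase_sum_H2_site[OF N(1)] H2_site_distinct[OF _ N(1)] by blast
  next
    case 4
    then show ?thesis by (rule subphrase_sum_H3_site[OF N(1)])
  qed
qed

lemma subphrase_sum_homotopy: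
  assumes "(p, q) \<in> homotopy \<alpha> \<tau> S r"
  shows "subphrase_sum \<alpha> r p - subphrase_sum \<alpha> r q \<in> relator_subgroup \<alpha> \<tau> S r"
proof -
  have "equivclp (homotopy_step \<alpha> \<tau> S r) p q"
    using assms by (simp add: homotopy_def)
  then show ?thesis
  proof (induction rule: equivclp_induct)
    case base
    then show ?case by (simp add: relator_subgroup_closed)
  next
    case (step y z)
    have "subphrase_sum \<alpha> r y - subphrase_sum \<alpha> r z \<in> relator_subgroup \<alpha> \<tau> S r"
      using step.hyps(2) subphrase_sum_step relator_subgroup_closed(3) minus_diff_eq by metis
    then show ?case
      using relator_subgroup_closed(2)[OF step.IH] by fastforce
  qed
qed

section \<open>The subphrase map and its inverse\<close>

lemma subphrase_sum_closed:
  "p \<in> nanophrases \<alpha> r \<Longrightarrow> subphrase_sum \<alpha> r p \<in> carrier (ZI \<alpha> r)"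
  unfolding subphrase_sum_def by (intro ZI_closed iclass_closed delete_letters_nanophrases)

definition homotopy_representative ::
  "'a set \<Rightarrow> ('a \<Rightarrow> 'a) \<Rightarrow> ('a \<times> 'a \<times> 'a) set \<Rightarrow> nat \<Rightarrow> 'a nanophrase set \<Rightarrow> 'a nanophrase" where
  "homotopy_representative \<alpha> \<tau> S r X =
    (SOME p. p \<in> nanophrases \<alpha> r \<and> X = homotopy \<alpha> \<tau> S r `` {p})"

text \<open>
  A lift of \<open>\<theta>\<close> with values in \<open>\<int>\<I>\<close>. It depends on the chosen representatives of homotopy classes;
  only its composition with the projection to \<open>G\<close> is canonical. Working with the lift makes it
  possible to compose with \<open>\<psi>\<close> before passing to quotients.
\<close>

definition subphrase_lift ::
  "'a set \<Rightarrow> ('a \<Rightarrow> 'a) \<Rightarrow> ('a \<times> 'a \<times> 'a) set \<Rightarrow> nat \<Rightarrow>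
   ('a nanophrase set \<Rightarrow>\<^sub>0 int) \<Rightarrow> ('a nanophrase set \<Rightarrow>\<^sub>0 int)" where
  "subphrase_lift \<alpha> \<tau> S r =
    frag_extend (\<lambda>X. subphrase_sum \<alpha> r (homotopy_representative \<alpha> \<tau> S r X))"

text \<open>
  The map \<open>\<psi>\<close>. Here the choice of representatives is immaterial, because \<^const>\<open>all_semi\<close> is
  invariant under isomorphism.
\<close>

definition all_semi_map ::
  "'a set \<Rightarrow> ('a \<Rightarrow> 'a) \<Rightarrow> ('a \<times> 'a \<times> 'a) set \<Rightarrow> nat \<Rightarrow>
   ('a nanophrase set \<Rightarrow>\<^sub>0 int) \<Rightarrow> ('a nanophrase set \<Rightarrow>\<^sub>0 int)" where
  "all_semi_map \<alpha> \<tau> S r =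
    frag_extend (\<lambda>X. all_semi \<alpha> \<tau> S r (SOME p. p \<in> nanophrases \<alpha> r \<and> X = isomorphism_rel \<alpha> r `` {p}))"

lemma homotopy_representative:
  fixes \<tau> :: "'a \<Rightarrow> 'a" and S :: "('a \<times> 'a \<times> 'a) set"
  assumes "p \<in> nanophrases \<alpha> r"
  defines "q \<equiv> homotopy_representative \<alpha> \<tau> S r (homotopy \<alpha> \<tau> S r `` {p})"
  shows "q \<in> nanophrases \<alpha> r" "(p, q) \<in> homotopy \<alpha> \<tau> S r"
proof -
  have "q \<in> nanophrases \<alpha> r \<and> homotopy \<alpha> \<tau> S r `` {p} = homotopy \<alpha> \<tau> S r `` {q}"
    unfolding q_def homotopy_representative_def
    by (rule someI[where x = p]) (simp add: assms(1))
  then show "q \<in> nanophrases \<alpha> r" "(p, q) \<in> homotopy \<alpha> \<tau> S r"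
    using eq_equiv_class[OF _ equiv_homotopy UNIV_I] by blast+
qed

lemma subphrase_lift_hclass:
  assumes "p \<in> nanophrases \<alpha> r"
  obtains q where "q \<in> nanophrases \<alpha> r" "(p, q) \<in> homotopy \<alpha> \<tau> S r"
    "subphrase_lift \<alpha> \<tau> S r (hclass \<alpha> \<tau> S r p) = subphrase_sum \<alpha> r q"
proof
  let ?q = "homotopy_representative \<alpha> \<tau> S r (homotopy \<alpha> \<tau> S r `` {p})"
  show "?q \<in> nanophrases \<alpha> r" "(p, ?q) \<in> homotopy \<alpha> \<tau> S r"
    by (rule homotopy_representative[OF assms])+
  show "subphrase_lift \<alpha> \<tau> S r (hclass \<alpha> \<tau> S r p) = subphrase_sum \<alpha> r ?q"
    by (simp add: subphrase_lift_def hclass_def)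
qed

lemma all_semi_map_iclass:
  assumes "p \<in> nanophrases \<alpha> r"
  shows "all_semi_map \<alpha> \<tau> S r (iclass \<alpha> r p) = all_semi \<alpha> \<tau> S r p"
proof -
  define q where "q = (SOME q. q \<in> nanophrases \<alpha> r \<and> isomorphism_rel \<alpha> r `` {p} = isomorphism_rel \<alpha> r `` {q})"
  have q: "q \<in> nanophrases \<alpha> r \<and> isomorphism_rel \<alpha> r `` {p} = isomorphism_rel \<alpha> r `` {q}"
    unfolding q_def by (rule someI[where x = p]) (simp add: assms)
  then have "(p, q) \<in> isomorphism_rel \<alpha> r"
    using eq_equiv_class[OF _ equiv_isomorphism_rel] by blast
  then have "isomorphic p q"
    by (simp add: isomorphism_rel_def)
  then have "all_semi \<alpha> \<tau> S r q = all_semi \<alpha> \<tau> S r p"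
    using q assms all_semi_isomorphic by metis
  then show ?thesis
    unfolding all_semi_map_def iclass_def frag_extend_of q_def[symmetric] .
qed

lemma frag_extend_hom:
  assumes "\<And>x. x \<in> X \<Longrightarrow> f x \<in> carrier (free_Abelian_group Y)"
  shows "frag_extend f \<in> hom (free_Abelian_group X) (free_Abelian_group Y)"
proof (rule homI)
  fix c assume "c \<in> carrier (free_Abelian_group X)"
  then have "(\<Union>x\<in>Poly_Mapping.keys c. Poly_Mapping.keys (f x)) \<subseteq> Y"
    using assms unfolding carrier_free_Abelian_group_iff by blast
  then show "frag_extend f c \<in> carrier (free_Abelian_group Y)"
    using keys_frag_extend[of f c] by simp
qed (simp add: frag_extend_add)

lemma ZP_generator:
  assumes "X \<in> homotopy_classes \<alpha> \<tau> S r"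
  obtains p where "p \<in> nanophrases \<alpha> r" "frag_of X = hclass \<alpha> \<tau> S r p"
  using assms by (auto simp: homotopy_classes_def hclass_def elim!: quotientE)

lemma ZI_generator:
  assumes "X \<in> nanophrases \<alpha> r // isomorphism_rel \<alpha> r"
  obtains p where "p \<in> nanophrases \<alpha> r" "frag_of X = iclass \<alpha> r p"
  using assms by (auto simp: iclass_def elim!: quotientE)

lemma subphrase_lift_hom: "subphrase_lift \<alpha> \<tau> S r \<in> hom (ZP \<alpha> \<tau> S r) (ZI \<alpha> r)"
  unfolding subphrase_lift_def ZP_def ZI_def
proof (rule frag_extend_hom)
  fix X assume "X \<in> homotopy_classes \<alpha> \<tau> S r"
  then obtain p where "p \<in> nanophrases \<alpha> r" "X = homotopy \<alpha> \<tau> S r `` {p}"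
    by (auto simp: homotopy_classes_def elim!: quotientE)
  then show "subphrase_sum \<alpha> r (homotopy_representative \<alpha> \<tau> S r X)
      \<in> carrier (free_Abelian_group (nanophrases \<alpha> r // isomorphism_rel \<alpha> r))"
    using homotopy_representative(1) subphrase_sum_closed unfolding ZI_def by blast
qed

lemma ZP_closed:
  "x \<in> carrier (ZP \<alpha> \<tau> S r) \<Longrightarrow> y \<in> carrier (ZP \<alpha> \<tau> S r) \<Longrightarrow> x - y \<in> carrier (ZP \<alpha> \<tau> S r)"
  using keys_diff[of x y] by (auto simp: ZP_def)

lemma semi_closed:
  "p \<in> nanophrases \<alpha> r \<Longrightarrow> semi \<alpha> \<tau> S r As p \<in> carrier (ZP \<alpha> \<tau> S r)"
proof (induction As arbitrary: p)
  case Nil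
  then show ?case by (simp add: hclass_closed)
next
  case (Cons A As)
  then show ?case
    unfolding semi.simps by (intro ZP_closed Cons.IH delete_letters_nanophrases)
qed

lemma all_semi_map_hom: "all_semi_map \<alpha> \<tau> S r \<in> hom (ZI \<alpha> r) (ZP \<alpha> \<tau> S r)"
  unfolding all_semi_map_def ZP_def ZI_def
proof (rule frag_extend_hom)
  fix X assume "X \<in> nanophrases \<alpha> r // isomorphism_rel \<alpha> r"
  then obtain p where p: "p \<in> nanophrases \<alpha> r" "X = isomorphism_rel \<alpha> r `` {p}"
    by (auto elim!: quotientE)
  have "all_semi \<alpha> \<tau> S r (SOME p. p \<in> nanophrases \<alpha> r \<and> X = isomorphism_rel \<alpha> r `` {p})
      = all_semi_map \<alpha> \<tau> S r (iclass \<alpha> r p)"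
    by (simp add: all_semi_map_def iclass_def p(2))
  also have "\<dots> \<in> carrier (ZP \<alpha> \<tau> S r)"
    unfolding all_semi_map_iclass[OF p(1)] all_semi_eq_semi by (rule semi_closed[OF p(1)])
  finally show "all_semi \<alpha> \<tau> S r (SOME p. p \<in> nanophrases \<alpha> r \<and> X = isomorphism_rel \<alpha> r `` {p})
      \<in> carrier (free_Abelian_group (homotopy_classes \<alpha> \<tau> S r))"
    by (simp add: ZP_def)
qed

lemma all_semi_map_add: "all_semi_map \<alpha> \<tau> S r (x + y) = all_semi_map \<alpha> \<tau> S r x + all_semi_map \<alpha> \<tau> S r y"
  and all_semi_map_diff: "all_semi_map \<alpha> \<tau> S r (x - y) = all_semi_map \<alpha> \<tau> S r x - all_semi_map \<alpha> \<tau> S r y"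
  by (simp_all add: all_semi_map_def frag_extend_add frag_extend_diff)

lemma all_semi_map_relators:
  assumes "c \<in> relators \<alpha> \<tau> S r"
  shows "all_semi_map \<alpha> \<tau> S r c = 0"
proof -
  have del: "all_semi_map \<alpha> \<tau> S r (iclass \<alpha> r (delete_letters D p)) = all_semi \<alpha> \<tau> S r (delete_letters D p)"
    if "p \<in> nanophrases \<alpha> r" for p D
    using that by (intro all_semi_map_iclass delete_letters_nanophrases)
  note simps = all_semi_map_add all_semi_map_diff all_semi_map_iclass del
  from assms show ?thesis
  proof (cases rule: relators_site_cases)
    case (H1 p A)
    then show ?thesis by (simp add: simps all_semi_H1_site)
  next
    case (H2 p A B)
    then show ?thesis
      using all_semi_H2_site[OF H2(1,2) H2_site_distinct[OF H2(2,1)]] by (simp add: simps)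
  next
    case (H3 p q A B C)
    then show ?thesis
      using all_semi_H3_site[OF H3(1,2)] H3_site_right_nanophrase[OF H3(2,1)] by (simp add: simps)
  qed
qed

lemma all_semi_map_subphrase_sum:
  assumes "p \<in> nanophrases \<alpha> r"
  shows "all_semi_map \<alpha> \<tau> S r (subphrase_sum \<alpha> r p) = hclass \<alpha> \<tau> S r p"
proof -
  have "all_semi_map \<alpha> \<tau> S r (subphrase_sum \<alpha> r p) =
      (\<Sum>D\<in>Pow (letters (fst p)). all_semi_map \<alpha> \<tau> S r (iclass \<alpha> r (delete_letters D p)))"
    by (simp add: subphrase_sum_def all_semi_map_def frag_extend_sum)
  also have "\<dots> = hclass \<alpha> \<tau> S r p"
    using assms by (simp add: all_semi_map_iclass delete_letters_nanophrases sum_all_semi_subphrases)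
  finally show ?thesis .
qed

text \<open>
  The equality is exact, not only modulo relators: on the class of \<open>p\<close> the lift is the subphrase
  sum of some \<open>q\<close> homotopic to \<open>p\<close>, which \<open>\<psi>\<close> maps to the homotopy class of \<open>q\<close>.
\<close>

lemma all_semi_map_subphrase_lift:
  assumes "x \<in> carrier (ZP \<alpha> \<tau> S r)"
  shows "all_semi_map \<alpha> \<tau> S r (subphrase_lift \<alpha> \<tau> S r x) = x"
proof (rule hom_free_Abelian_group_eqI[of "ZP \<alpha> \<tau> S r" "all_semi_map \<alpha> \<tau> S r \<circ> subphrase_lift \<alpha> \<tau> S r"
      "homotopy_classes \<alpha> \<tau> S r" "\<lambda>x. x", unfolded comp_def])
  show "(\<lambda>x. all_semi_map \<alpha> \<tau> S r (subphrase_lift \<alpha> \<tau> S r x))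
      \<in> hom (free_Abelian_group (homotopy_classes \<alpha> \<tau> S r)) (ZP \<alpha> \<tau> S r)"
    using hom_compose[OF subphrase_lift_hom all_semi_map_hom] by (simp add: comp_def ZP_def)
  fix X assume "X \<in> homotopy_classes \<alpha> \<tau> S r"
  then obtain p where p: "p \<in> nanophrases \<alpha> r" "frag_of X = hclass \<alpha> \<tau> S r p"
    by (rule ZP_generator)
  obtain q where "q \<in> nanophrases \<alpha> r" "(p, q) \<in> homotopy \<alpha> \<tau> S r"
    "subphrase_lift \<alpha> \<tau> S r (hclass \<alpha> \<tau> S r p) = subphrase_sum \<alpha> r q"
    using subphrase_lift_hclass[OF p(1)] .
  then show "all_semi_map \<alpha> \<tau> S r (subphrase_lift \<alpha> \<tau> S r (frag_of X)) = frag_of X"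
    using p(2) by (simp add: all_semi_map_subphrase_sum hclass_eq_iff[symmetric])
qed (use assms in \<open>simp_all add: ZP_def hom_def\<close>)

section \<open>The map \<open>\<Gamma>\<close>\<close>

lemma hom_cong_on_carrier:
  assumes "group G" "f \<in> hom G H" "\<And>x. x \<in> carrier G \<Longrightarrow> g x = f x"
  shows "g \<in> hom G H"
proof -
  interpret group G by (rule assms(1))
  show ?thesis
    using assms(2,3) by (simp add: hom_def Pi_def)
qed

text \<open>
  Both the existence and the uniqueness in the description of \<open>\<theta>\<close> are needed. The existence rests
  on the homotopy invariance of the subphrase sum modulo relators.
\<close>

lemma theta_hat_eq:
  assumes "x \<in> carrier (ZP \<alpha> \<tau> S r)"
  shows "theta_hat \<alpha> \<tau> S r x = G_proj \<alpha> \<tau> S r (subphrase_lift \<alpha> \<tau> S r x)"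
proof -
  let ?h = "restrict (G_proj \<alpha> \<tau> S r \<circ> subphrase_lift \<alpha> \<tau> S r) (carrier (ZP \<alpha> \<tau> S r))"
  have grp: "group (ZP \<alpha> \<tau> S r)" "group (G_grp \<alpha> \<tau> S r)"
    using comm_group.axioms(2)[OF comm_group_G_grp] by (simp_all add: ZP_def)
  have hom: "?h \<in> hom (ZP \<alpha> \<tau> S r) (G_grp \<alpha> \<tau> S r)"
    by (rule hom_cong_on_carrier[OF grp(1) hom_compose[OF subphrase_lift_hom G_proj_hom]]) simp
  have val: "?h (hclass \<alpha> \<tau> S r p) = G_proj \<alpha> \<tau> S r (subphrase_sum \<alpha> r p)"
    if p: "p \<in> nanophrases \<alpha> r" for p
  proof -
    obtain q where q: "q \<in> nanophrases \<alpha> r" "(p, q) \<in> homotopy \<alpha> \<tau> S r"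
      "subphrase_lift \<alpha> \<tau> S r (hclass \<alpha> \<tau> S r p) = subphrase_sum \<alpha> r q"
      using subphrase_lift_hclass[OF p] .
    have "G_proj \<alpha> \<tau> S r (subphrase_sum \<alpha> r p) = G_proj \<alpha> \<tau> S r (subphrase_sum \<alpha> r q)"
      using p q by (intro G_proj_eq subphrase_sum_closed subphrase_sum_homotopy)
    then show ?thesis
      using q(3) hclass_closed[OF p] by simp
  qed
  have "theta_hat \<alpha> \<tau> S r = ?h"
    unfolding theta_hat_def
  proof (rule the_equality)
    fix k assume k: "k \<in> hom (ZP \<alpha> \<tau> S r) (G_grp \<alpha> \<tau> S r) \<and> k \<in> extensional (carrier (ZP \<alpha> \<tau> S r)) \<and>
        (\<forall>p\<in>nanophrases \<alpha> r. k (hclass \<alpha> \<tau> S r p) = G_proj \<alpha> \<tau> S r (subphrase_sum \<alpha> r p))"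
    show "k = ?h"
    proof (rule extensionalityI)
      fix x assume "x \<in> carrier (ZP \<alpha> \<tau> S r)"
      then show "k x = ?h x"
      proof (intro hom_free_Abelian_group_eqI[OF grp(2), of k _ ?h x])
        fix X assume "X \<in> homotopy_classes \<alpha> \<tau> S r"
        then obtain p where "p \<in> nanophrases \<alpha> r" "frag_of X = hclass \<alpha> \<tau> S r p"
          by (rule ZP_generator)
        then show "k (frag_of X) = ?h (frag_of X)"
          using k val by (simp del: restrict_apply)
      qed (use k hom in \<open>simp_all only: ZP_def\<close>)
    qed (use k in \<open>blast intro: restrict_extensional\<close>)+
  qed (use hom val in \<open>blast intro: restrict_extensional\<close>)
  then show ?thesis
    using assms by simp
qed

text \<open>
  The projection to \<open>G\<^sub>n\<close> already sends phrases of rank greater than \<open>n\<close> to the neutral element, so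
  it has the property that characterizes \<open>O\<^sub>n\<close>.
\<close>

lemma O_map_eq:
  assumes "X \<in> carrier (G_grp \<alpha> \<tau> S r)"
  shows "O_map n \<alpha> \<tau> S r X = Gn_proj n \<alpha> \<tau> S r X"
proof -
  let ?h = "restrict (Gn_proj n \<alpha> \<tau> S r) (carrier (G_grp \<alpha> \<tau> S r))"
  have grp: "group (Gn n \<alpha> \<tau> S r)" "group (G_grp \<alpha> \<tau> S r)"
    by (intro comm_group.axioms(2) comm_group_G_grp comm_group_Gn)+
  have cl: "G_proj \<alpha> \<tau> S r c \<in> carrier (G_grp \<alpha> \<tau> S r)" if "c \<in> carrier (ZI \<alpha> r)" for c
    using hom_in_carrier[OF G_proj_hom that] .
  have hom: "?h \<in> hom (G_grp \<alpha> \<tau> S r) (Gn n \<alpha> \<tau> S r)"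
    by (rule hom_cong_on_carrier[OF grp(2) Gn_proj_hom]) simp
  have val: "?h (G_proj \<alpha> \<tau> S r (iclass \<alpha> r p)) =
      (if rank p \<le> n then Gn_proj n \<alpha> \<tau> S r (G_proj \<alpha> \<tau> S r (iclass \<alpha> r p)) else \<one>\<^bsub>Gn n \<alpha> \<tau> S r\<^esub>)"
    if "p \<in> nanophrases \<alpha> r" for p
    using that Gn_proj_high_rank[OF that, of n \<tau> S] cl[OF iclass_closed[OF that]] by simp
  have "O_map n \<alpha> \<tau> S r = ?h"
    unfolding O_map_def
  proof (rule the_equality)
    fix k assume k: "k \<in> hom (G_grp \<alpha> \<tau> S r) (Gn n \<alpha> \<tau> S r) \<and>
        k \<in> extensional (carrier (G_grp \<alpha> \<tau> S r)) \<and>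
        (\<forall>p\<in>nanophrases \<alpha> r. k (G_proj \<alpha> \<tau> S r (iclass \<alpha> r p)) =
           (if rank p \<le> n then Gn_proj n \<alpha> \<tau> S r (G_proj \<alpha> \<tau> S r (iclass \<alpha> r p))
            else \<one>\<^bsub>Gn n \<alpha> \<tau> S r\<^esub>))"
    show "k = ?h"
    proof (rule extensionalityI)
      fix X assume "X \<in> carrier (G_grp \<alpha> \<tau> S r)"
      then obtain c where c: "c \<in> carrier (ZI \<alpha> r)" "X = G_proj \<alpha> \<tau> S r c"
        using G_proj_surj by blast
      have "(k \<circ> G_proj \<alpha> \<tau> S r) c = (?h \<circ> G_proj \<alpha> \<tau> S r) c"
      proof (rule hom_free_Abelian_group_eqI[OF grp(1)])
        show "k \<circ> G_proj \<alpha> \<tau> S r \<in> hom (free_Abelian_group (nanophrases \<alpha> r // isomorphism_rel \<alpha> r))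
            (Gn n \<alpha> \<tau> S r)"
          using hom_compose[OF G_proj_hom] k unfolding ZI_def by blast
        show "?h \<circ> G_proj \<alpha> \<tau> S r \<in> hom (free_Abelian_group (nanophrases \<alpha> r // isomorphism_rel \<alpha> r))
            (Gn n \<alpha> \<tau> S r)"
          using hom_compose[OF G_proj_hom hom] unfolding ZI_def .
        show "(k \<circ> G_proj \<alpha> \<tau> S r) (frag_of Y) = (?h \<circ> G_proj \<alpha> \<tau> S r) (frag_of Y)"
          if Y: "Y \<in> nanophrases \<alpha> r // isomorphism_rel \<alpha> r" for Y
        proof -
          obtain p where "p \<in> nanophrases \<alpha> r" "frag_of Y = iclass \<alpha> r p"
            using ZI_generator[OF Y] .
          then show ?thesis
            using k val by (metis comp_apply)
        qed
        show "c \<in> carrier (free_Abelian_group (nanophrases \<alpha> r // isomorphism_rel \<alpha> r))"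
          using c(1) unfolding ZI_def .
      qed
      then show "k X = ?h X"
        by (simp add: c(2))
    qed (use k in \<open>blast intro: restrict_extensional\<close>)+
  qed (use hom val in \<open>blast intro: restrict_extensional\<close>)
  then show ?thesis
    using assms by simp
qed

lemma Gamma_eq:
  assumes "x \<in> carrier (ZP \<alpha> \<tau> S r)"
  shows "Gamma n \<alpha> \<tau> S r x = Gn_proj n \<alpha> \<tau> S r (G_proj \<alpha> \<tau> S r (subphrase_lift \<alpha> \<tau> S r x))"
  unfolding Gamma_def comp_apply theta_hat_eq[OF assms]
  by (intro O_map_eq hom_in_carrier[OF G_proj_hom] hom_in_carrier[OF subphrase_lift_hom] assms)

lemma Gamma_hom: "Gamma n \<alpha> \<tau> S r \<in> hom (ZP \<alpha> \<tau> S r) (Gn n \<alpha> \<tau> S r)"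
proof (rule hom_cong_on_carrier)
  show "Gn_proj n \<alpha> \<tau> S r \<circ> (G_proj \<alpha> \<tau> S r \<circ> subphrase_lift \<alpha> \<tau> S r) \<in> hom (ZP \<alpha> \<tau> S r) (Gn n \<alpha> \<tau> S r)"
    by (rule hom_compose[OF hom_compose[OF subphrase_lift_hom G_proj_hom] Gn_proj_hom])
qed (simp_all add: Gamma_eq, simp add: ZP_def)

lemma subphrase_lift_diff:
  "subphrase_lift \<alpha> \<tau> S r (x - y) = subphrase_lift \<alpha> \<tau> S r x - subphrase_lift \<alpha> \<tau> S r y"
  by (simp add: subphrase_lift_def frag_extend_diff)

text \<open>
  Marking \<open>A\<close> subtracts the subphrases of the phrase without \<open>A\<close>, hence only the subphrases that
  contain \<open>A\<close> survive. The equality holds modulo relators since the lift involves a choice of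
  representatives.
\<close>

lemma subphrase_lift_semi:
  assumes "p \<in> nanophrases \<alpha> r" "distinct As" "set As \<subseteq> letters (fst p)"
  shows "subphrase_lift \<alpha> \<tau> S r (semi \<alpha> \<tau> S r As p)
    - deletion_sum 1 (iclass \<alpha> r) (letters (fst p) - set As) p \<in> relator_subgroup \<alpha> \<tau> S r"
  using assms
proof (induction As arbitrary: p)
  case Nil
  obtain q where q: "(p, q) \<in> homotopy \<alpha> \<tau> S r"
    "subphrase_lift \<alpha> \<tau> S r (hclass \<alpha> \<tau> S r p) = subphrase_sum \<alpha> r q"
    using subphrase_lift_hclass[OF Nil(1)] .
  have "- (subphrase_sum \<alpha> r p - subphrase_sum \<alpha> r q) \<in> relator_subgroup \<alpha> \<tau> S r"
    by (rule relator_subgroup_closed(3)[OF subphrase_sum_homotopy[OF q(1)]])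
  then show ?case
    by (simp add: q(2) subphrase_sum_eq)
next
  case (Cons A As)
  let ?p = "delete_letters {A} p" and ?L = "letters (fst p) - set (A # As)"
    and ?s = "deletion_sum 1 (iclass \<alpha> r)"
  have L: "letters (fst p) - set As = insert A ?L" "letters (fst ?p) - set As = ?L"
    using Cons.prems by auto
  have "?s (letters (fst p) - set As) p - ?s (letters (fst ?p) - set As) ?p = ?s ?L p"
    unfolding L by (subst deletion_sum_insert) auto
  moreover have "subphrase_lift \<alpha> \<tau> S r (semi \<alpha> \<tau> S r As p) - ?s (letters (fst p) - set As) p
      \<in> relator_subgroup \<alpha> \<tau> S r"
    using Cons.prems by (intro Cons.IH) auto
  moreover have "subphrase_lift \<alpha> \<tau> S r (semi \<alpha> \<tau> S r As ?p) - ?s (letters (fst ?p) - set As) ?p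
      \<in> relator_subgroup \<alpha> \<tau> S r"
    using Cons.prems by (intro Cons.IH delete_letters_nanophrases) auto
  ultimately show ?case
    using relator_subgroup_closed(4) by (fastforce simp: subphrase_lift_diff algebra_simps)
qed

lemma hom_sum_one:
  assumes "group G" "h \<in> hom (ZI \<alpha> r) G"
    and "\<And>i. i \<in> I \<Longrightarrow> f i \<in> carrier (ZI \<alpha> r) \<and> h (f i) = \<one>\<^bsub>G\<^esub>"
  shows "h (sum f I) = \<one>\<^bsub>G\<^esub>"
proof -
  interpret group_hom "ZI \<alpha> r" G h
    using assms(1,2) group_ZI by (simp add: group_hom_def group_hom_axioms_def)
  have "sum f I \<in> kernel (ZI \<alpha> r) G h"
    using assms(3) by (intro subgroup_ZI_closed(5)[OF subgroup_kernel]) (simp add: kernel_def)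
  then show ?thesis
    by (simp add: kernel_def)
qed

lemma Gamma_vanishes: "vanishes_above \<alpha> \<tau> S r (Gn n \<alpha> \<tau> S r) (Gamma n \<alpha> \<tau> S r) n"
  unfolding vanishes_above_def
proof (intro ballI allI impI)
  fix p As assume p: "p \<in> nanophrases \<alpha> r"
    and As: "distinct As \<and> set As \<subseteq> letters (fst p) \<and> n < length As"
  let ?L = "letters (fst p) - set As" and ?P = "\<lambda>c. Gn_proj n \<alpha> \<tau> S r (G_proj \<alpha> \<tau> S r c)"
  \<comment> \<open>Every surviving subphrase contains all letters of \<open>As\<close>, so its rank is at least \<open>length As > n\<close>.\<close>
  have D: "iclass \<alpha> r (delete_letters D p) \<in> carrier (ZI \<alpha> r) \<and>
      ?P (iclass \<alpha> r (delete_letters D p)) = \<one>\<^bsub>Gn n \<alpha> \<tau> S r\<^esub>" if "D \<in> Pow ?L" for D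
  proof -
    have "set As \<subseteq> letters (fst p) - D"
      using that As by auto
    then have "length As \<le> rank (delete_letters D p)"
      using As by (simp add: rank_def card_mono flip: distinct_card)
    then show ?thesis
      using As p by (intro conjI iclass_closed Gn_proj_high_rank delete_letters_nanophrases) auto
  qed
  have sum: "deletion_sum 1 (iclass \<alpha> r) ?L p = (\<Sum>D\<in>Pow ?L. iclass \<alpha> r (delete_letters D p))"
    by (simp add: deletion_sum_def)
  have "Gamma n \<alpha> \<tau> S r (semi \<alpha> \<tau> S r As p) = ?P (subphrase_lift \<alpha> \<tau> S r (semi \<alpha> \<tau> S r As p))"
    by (intro Gamma_eq semi_closed p)
  also have "\<dots> = ?P (\<Sum>D\<in>Pow ?L. iclass \<alpha> r (delete_letters D p))"
    unfolding sum[symmetric] using As p D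
    by (intro arg_cong[where f = "Gn_proj n \<alpha> \<tau> S r"] G_proj_eq subphrase_lift_semi
        hom_in_carrier[OF subphrase_lift_hom semi_closed]) (auto simp: sum intro!: ZI_closed(5))
  also have "\<dots> = \<one>\<^bsub>Gn n \<alpha> \<tau> S r\<^esub>"
    using hom_sum_one[OF comm_group.axioms(2)[OF comm_group_Gn] hom_compose[OF G_proj_hom Gn_proj_hom],
        of "Pow ?L" "\<lambda>D. iclass \<alpha> r (delete_letters D p)"] D
    unfolding comp_apply by blast
  finally show "Gamma n \<alpha> \<tau> S r (semi \<alpha> \<tau> S r As p) = \<one>\<^bsub>Gn n \<alpha> \<tau> S r\<^esub>" .
qed

section \<open>Universality\<close>

text \<open>
  The degree is attained as a least element because some bound exists, and a bound stays a bound
  when it is enlarged.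
\<close>

lemma vanishes_above_ft_degree:
  assumes "finite_type_invariant \<alpha> \<tau> S r H v" "ft_degree \<alpha> \<tau> S r H v \<le> n"
  shows "vanishes_above \<alpha> \<tau> S r H v n"
proof -
  have "vanishes_above \<alpha> \<tau> S r H v (ft_degree \<alpha> \<tau> S r H v)"
    using assms(1) unfolding finite_type_invariant_def ft_degree_def by (metis LeastI)
  then show ?thesis
    using assms(2) unfolding vanishes_above_def by (meson le_less_trans)
qed

lemma hom_Gn_factorization:
  assumes H: "comm_group H" and h: "h \<in> hom (ZI \<alpha> r) H"
    and rel: "\<And>c. c \<in> relators \<alpha> \<tau> S r \<Longrightarrow> h c = \<one>\<^bsub>H\<^esub>"
    and rank: "\<And>p. p \<in> nanophrases \<alpha> r \<Longrightarrow> rank p > n \<Longrightarrow> h (iclass \<alpha> r p) = \<one>\<^bsub>H\<^esub>"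
  obtains f where "f \<in> hom (Gn n \<alpha> \<tau> S r) H"
    "\<And>c. c \<in> carrier (ZI \<alpha> r) \<Longrightarrow> f (Gn_proj n \<alpha> \<tau> S r (G_proj \<alpha> \<tau> S r c)) = h c"
proof -
  note gH = comm_group.axioms(2)[OF H]
  interpret h: group_hom "ZI \<alpha> r" H h
    using gH h group_ZI by (simp add: group_hom_def group_hom_axioms_def)
  obtain g where g: "g \<in> hom (G_grp \<alpha> \<tau> S r) H"
    and gh: "\<And>c. c \<in> carrier (ZI \<alpha> r) \<Longrightarrow> g (G_proj \<alpha> \<tau> S r c) = h c"
    using h.factor_Mod_generate[OF comm_group_ZI relators_subset rel]
    unfolding G_grp_def G_proj_def relator_subgroup_def by blast
  interpret g: group_hom "G_grp \<alpha> \<tau> S r" H g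
    using g gH comm_group.axioms(2)[OF comm_group_G_grp]
    by (simp add: group_hom_def group_hom_axioms_def)
  have "g k = \<one>\<^bsub>H\<^esub>" if "k \<in> high_rank_classes n \<alpha> \<tau> S r" for k
    using that gh rank iclass_closed unfolding high_rank_classes_def by force
  then obtain f where f: "f \<in> hom (Gn n \<alpha> \<tau> S r) H"
    and fg: "\<And>X. X \<in> carrier (G_grp \<alpha> \<tau> S r) \<Longrightarrow> f (Gn_proj n \<alpha> \<tau> S r X) = g X"
    using g.factor_Mod_generate[OF comm_group_G_grp high_rank_classes_subset]
    unfolding Gn_def Gn_proj_def high_rank_subgroup_eq by blast
  show thesis
    using that[OF f] fg gh hom_in_carrier[OF G_proj_hom] by metis
qed

theorem proposition5p9:
  fixes \<alpha> :: "'a set" and \<tau> :: "'a \<Rightarrow> 'a" and S :: "('a \<times> 'a \<times> 'a) set" and n r :: nat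
  assumes "finite \<alpha>"
    and "\<tau> \<in> \<alpha> \<rightarrow> \<alpha>" and "\<And>a. a \<in> \<alpha> \<Longrightarrow> \<tau> (\<tau> a) = a"
    and "S \<subseteq> \<alpha> \<times> \<alpha> \<times> \<alpha>"
    and "n > 0" and "r > 0"
  shows "universal_invariant TYPE('h) \<alpha> \<tau> S r n (Gn n \<alpha> \<tau> S r) (Gamma n \<alpha> \<tau> S r)"
  unfolding universal_invariant_def
proof (intro conjI allI impI)
  show "finite_type_invariant \<alpha> \<tau> S r (Gn n \<alpha> \<tau> S r) (Gamma n \<alpha> \<tau> S r)"
    unfolding finite_type_invariant_def homotopy_invariant_def
    using comm_group_Gn Gamma_hom Gamma_vanishes by blast
  show "ft_degree \<alpha> \<tau> S r (Gn n \<alpha> \<tau> S r) (Gamma n \<alpha> \<tau> S r) \<le> n"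
    unfolding ft_degree_def by (rule Least_le) (rule Gamma_vanishes)
next
  fix H :: "'h monoid" and v
  assume v: "finite_type_invariant \<alpha> \<tau> S r H v \<and> ft_degree \<alpha> \<tau> S r H v \<le> n"
  then have H: "comm_group H" and hom: "v \<in> hom (ZP \<alpha> \<tau> S r) H"
    by (auto simp: finite_type_invariant_def homotopy_invariant_def)
  have van: "vanishes_above \<alpha> \<tau> S r H v n"
    using v vanishes_above_ft_degree by blast
  \<comment> \<open>The relators already vanish under \<open>\<psi>\<close>, so \<open>v \<circ> \<psi>\<close> sends them to \<open>v 0\<close>.\<close>
  have v0: "v 0 = \<one>\<^bsub>H\<^esub>"
    using hom_one[OF hom] comm_group.axioms(2)[OF H] by (simp add: ZP_def)
  obtain f where f: "f \<in> hom (Gn n \<alpha> \<tau> S r) H"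
    and fv: "\<And>c. c \<in> carrier (ZI \<alpha> r) \<Longrightarrow>
      f (Gn_proj n \<alpha> \<tau> S r (G_proj \<alpha> \<tau> S r c)) = (v \<circ> all_semi_map \<alpha> \<tau> S r) c"
  proof (rule hom_Gn_factorization[OF H hom_compose[OF all_semi_map_hom hom], where n = n])
    fix f assume "f \<in> hom (Gn n \<alpha> \<tau> S r) H" "\<And>c. c \<in> carrier (ZI \<alpha> r) \<Longrightarrow>
      f (Gn_proj n \<alpha> \<tau> S r (G_proj \<alpha> \<tau> S r c)) = (v \<circ> all_semi_map \<alpha> \<tau> S r) c"
    then show thesis by (rule that)
  next
    show "(v \<circ> all_semi_map \<alpha> \<tau> S r) c = \<one>\<^bsub>H\<^esub>" if "c \<in> relators \<alpha> \<tau> S r" for c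
      using all_semi_map_relators[OF that] v0 by simp
    show "(v \<circ> all_semi_map \<alpha> \<tau> S r) (iclass \<alpha> r p) = \<one>\<^bsub>H\<^esub>"
      if "p \<in> nanophrases \<alpha> r" "rank p > n" for p
      using van that
      by (simp add: all_semi_map_iclass all_semi_eq_semi vanishes_above_def rank_def)
  qed
  have "v x = f (Gamma n \<alpha> \<tau> S r x)" if "x \<in> carrier (ZP \<alpha> \<tau> S r)" for x
    using fv[OF hom_in_carrier[OF subphrase_lift_hom that]]
    by (simp add: Gamma_eq[OF that] all_semi_map_subphrase_lift[OF that])
  then show "\<exists>f\<in>hom (Gn n \<alpha> \<tau> S r) H. \<forall>x\<in>carrier (ZP \<alpha> \<tau> S r). v x = f (Gamma n \<alpha> \<tau> S r x)"
    using f by blast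
qed

end
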